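(* For $m=0,1,2,3,4$, $$q^{m/5}(q;q)_\infty\sum_{n=0}^{\infty}p(25n+24+5m)\,q^{n}=\frac{\Omega_{5,m}\Bigl(L_{2,\chi_{3,5}}^{5}(q)\cdot\Omega_{5,0}\bigl(L_{2,\chi_{3,5}}(q)\bigr)\Bigr)}{E_{2,\chi_{3,5}}^{5}(q)\,L_{2,\chi_{3,5}}(q)}.$$ Moreover, when $m=0$, this identity is equivalent to Ramanujan's expansion $$\sum_{n=0}^{\infty}p(25n+24)q^n=5^2\cdot63\frac{(q^5;q^5)_\infty^6}{(q;q)_\infty^7}+5^5q\cdot52\frac{(q^5;q^5)_\infty^{12}}{(q;q)_\infty^{13}}+5^7q^2\cdot63\frac{(q^5;q^5)_\infty^{18}}{(q;q)_\infty^{19}}+5^{10}q^3\cdot6\frac{(q^5;q^5)_\infty^{24}}{(q;q)_\infty^{25}}+5^{12}q^4\frac{(q^5;q^5)_\infty^{30}}{(q;q)_\infty^{31}}.$$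
   Context: Here $|q|<1$ and $(a;q)_\infty=\prod_{k\ge0}(1-aq^k)$. $p(n)$ is the number of partitions of $n$, so $\sum_{n\ge0}p(n)q^n=1/(q;q)_\infty$. The character $\chi_{3,5}$ is the Dirichlet character modulo $5$ with values $0,1,-1,-1,1$ at $n=0,1,2,3,4$ (the Legendre symbol modulo $5$). The weight-two Eisenstein series are $$L_{2,\chi_{3,5}}(q)=\sum_{n=1}^{\infty}\frac{n}{1-q^{5n}}\sum_{j=1}^{4}\chi_{3,5}(j)q^{jn},\qquad E_{2,\chi_{3,5}}(q)=1-5\sum_{n=1}^{\infty}\chi_{3,5}(n)\frac{nq^n}{1-q^n}.$$ For $m=0,1,2,3,4$ the operators $\Omega_{5,m}$ act on power series by $\Omega_{5,m}\bigl(\sum_{n\ge0}a_nq^n\bigr)=\sum_{n\ge0}a_{5n+m}q^n$.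
   Formalization: As printed the identity fails (m=0: as q→0 the left side tends to p(24)=1575, the right side to 0). Proved instead, for 0<|q|<1, with left side q(q;q)_∞ Σ_{n≥-1} p(25n+24+5m)q^n, p(-1)=0; the equivalence with Ramanujan's expansion is for this corrected m=0 identity. *)

theory Defs
  imports "HOL-Complex_Analysis.Complex_Analysis"
begin

definition qpoch_inf :: "complex \<Rightarrow> complex \<Rightarrow> complex" where
  "qpoch_inf a q = (\<Prod>k. 1 - a * q ^ k)"

text \<open>
  A partition of \<open>n\<close> is the multiset of its (positive) parts. The argument is an integer, so that
  \<open>num_partitions n = 0\<close> for negative \<open>n\<close>, the usual convention.
\<close>
definition num_partitions :: "int \<Rightarrow> nat" where
  "num_partitions n = card {M :: nat multiset. 0 \<notin># M \<and> int (sum_mset M) = n}"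

definition chi35 :: "nat \<Rightarrow> complex" where
  "chi35 n = [0, 1, -1, -1, 1] ! (n mod 5)"

definition L2 :: "complex \<Rightarrow> complex" where
  "L2 q = (\<Sum>n. of_nat (Suc n) / (1 - q ^ (5 * Suc n)) * (\<Sum>j=1..4. chi35 j * q ^ (j * Suc n)))"

definition E2 :: "complex \<Rightarrow> complex" where
  "E2 q = 1 - 5 * (\<Sum>n. chi35 (Suc n) * (of_nat (Suc n) * q ^ Suc n / (1 - q ^ Suc n)))"

text \<open>
  The operator \<open>\<Omega>\<^sub>5\<^sub>,\<^sub>m\<close>, acting on a function \<open>f\<close> holomorphic near 0 through the coefficients
  of its Taylor series at 0.
\<close>
definition Omega5 :: "nat \<Rightarrow> (complex \<Rightarrow> complex) \<Rightarrow> complex \<Rightarrow> complex" where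
  "Omega5 m f q = (\<Sum>n. fps_nth (fps_expansion f 0) (5 * n + m) * q ^ n)"

text \<open>
  The dissection identity for the residue \<open>m\<close>. In the source it is printed with left-hand side
  \<open>q\<^bsup>m/5\<^esup> (q;q)\<^sub>\<infinity> \<Sum>\<^bsub>n\<ge>0\<^esub> p(25n+24+5m) q\<^bsup>n\<^esup>\<close>, which cannot hold: \<open>L2 q = q + O(q^2)\<close>, so for
  \<open>m = 0\<close> the right-hand side is \<open>O(q)\<close>, whereas the printed left-hand side tends to \<open>p(24) = 1575\<close>;
  for \<open>m > 0\<close> the right-hand side has no fractional powers of \<open>q\<close>. The correct left-hand side
  is \<open>q (q;q)\<^sub>\<infinity> \<Sum>\<^bsub>n\<ge>-1\<^esub> p(25n+24+5m) q\<^bsup>n\<^esup>\<close>; below, the term for \<open>n = -1\<close>, which is 0 for \<open>m = 0\<close>,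
  is written separately.
  The point \<open>q = 0\<close> is excluded because \<open>L2\<close> vanishes there.
\<close>
definition dissection_identity :: "nat \<Rightarrow> bool" where
  "dissection_identity m \<longleftrightarrow>
     (\<forall>q. 0 < norm q \<and> norm q < 1 \<longrightarrow>
        qpoch_inf q q *
          (of_nat (num_partitions (5 * int m - 1)) +
           q * (\<Sum>n. of_nat (num_partitions (25 * int n + 24 + 5 * int m)) * q ^ n)) =
        Omega5 m (\<lambda>z. L2 z ^ 5 * Omega5 0 L2 z) q / (E2 q ^ 5 * L2 q))"

definition ramanujan_expansion :: bool where
  "ramanujan_expansion \<longleftrightarrow>
     (\<forall>q. norm q < 1 \<longrightarrow>
        (\<Sum>n. of_nat (num_partitions (25 * int n + 24)) * q ^ n) =
          5 ^ 2 * 63 * (qpoch_inf (q ^ 5) (q ^ 5) ^ 6 / qpoch_inf q q ^ 7)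
        + 5 ^ 5 * q * 52 * (qpoch_inf (q ^ 5) (q ^ 5) ^ 12 / qpoch_inf q q ^ 13)
        + 5 ^ 7 * q ^ 2 * 63 * (qpoch_inf (q ^ 5) (q ^ 5) ^ 18 / qpoch_inf q q ^ 19)
        + 5 ^ 10 * q ^ 3 * 6 * (qpoch_inf (q ^ 5) (q ^ 5) ^ 24 / qpoch_inf q q ^ 25)
        + 5 ^ 12 * q ^ 4 * (qpoch_inf (q ^ 5) (q ^ 5) ^ 30 / qpoch_inf q q ^ 31))"

end

theory Submission
  imports Defs
begin

text \<open>
  Write \<open>E(q) = (q;q)\<^sub>\<infinity>\<close>. The Eisenstein series are the quotients
  \<open>L\<^sub>2 = q E(q\<^sup>5)\<^sup>5 / E(q)\<close> and \<open>E\<^sub>2 = E(q)\<^sup>5 / E(q\<^sup>5)\<close>. Both are instances, at nome \<open>q\<^sup>5\<close> and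
  \<open>(a, b) = (q, q\<^sup>2)\<close> and at nome \<open>q\<close> and \<open>(a, b) = (\<zeta>, \<zeta>\<^sup>2)\<close> for a primitive fifth root of unity \<open>\<zeta>\<close>, of the formula expressing a
  difference \<open>\<wp>(a) - \<wp>(b)\<close> of Weierstrass functions by theta functions. The coefficient of \<open>q\<^sup>n\<close> in \<open>L\<^sub>2\<close>
  being the sum of \<open>d \<chi>(n/d)\<close> over \<open>d | n\<close>, one has \<open>\<Omega>\<^sub>5\<^sub>,\<^sub>0 L\<^sub>2 = 5 L\<^sub>2\<close>; since \<open>L\<^sub>2\<close> is \<open>q E(q\<^sup>5)\<^sup>5\<close> times
  the generating function of partitions, this is Ramanujan's formula for \<open>p(5n+4)\<close>, and it yields
  \<open>5 L\<^sub>2\<^sup>6 = q\<^sup>6 E(q\<^sup>5)\<^bsup>25\<^esup> \<Sum> p(5n+4) q\<^sup>n\<close>. Applying \<open>\<Omega>\<^sub>5\<^sub>,\<^sub>m\<close> to both sides proves the dissection identity.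

  Since the case \<open>m = 0\<close> holds, its equivalence with Ramanujan's expansion amounts to proving the latter.
  By the pentagonal number theorem \<open>E\<close> is a sum \<open>A - c + C\<close> of three parts with exponents in one residue class
  modulo 5 each, where \<open>c = q E(q\<^bsup>25\<^esup>)\<close>. The formula for \<open>p(5n+4)\<close> forces \<open>A C = - c\<^sup>2\<close>, which turns the product
  of the \<open>E(\<zeta>\<^sup>i q)\<close> into a quintic equation for \<open>w = c / E\<close> with coefficients in \<open>q\<^sup>5\<close>. Hence
  \<open>\<Omega>\<^sub>5\<^sub>,\<^sub>0 (w\<^sup>n)\<close> satisfies a linear recurrence, and \<open>n = 6\<close> is Ramanujan's expansion.
\<close>

subsection \<open>The q-Pochhammer symbol\<close>

lemma convergent_prod_qpoch:
  assumes "norm q < 1"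
  shows "convergent_prod (\<lambda>k. 1 - a * q ^ k :: complex)"
proof -
  have "summable (\<lambda>k. norm a * norm q ^ k)"
    using assms by (intro summable_mult summable_geometric) auto
  hence "abs_convergent_prod (\<lambda>k. 1 - a * q ^ k)"
    by (simp add: abs_convergent_prod_conv_summable norm_mult norm_power)
  thus ?thesis
    by (rule abs_convergent_prod_imp_convergent_prod)
qed

lemma qpoch_LIMSEQ:
  assumes "norm q < 1"
  shows "(\<lambda>n. \<Prod>k<n. 1 - a * q ^ k) \<longlonglongrightarrow> qpoch_inf a q"
  unfolding qpoch_inf_def LIMSEQ_lessThan_iff_atMost
  by (rule convergent_prod_LIMSEQ) (rule convergent_prod_qpoch[OF assms])

lemma qpoch_inf_rec:
  assumes "norm q < 1"
  shows "qpoch_inf a q = (1 - a) * qpoch_inf (a * q) q"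
proof -
  have "(\<lambda>n. \<Prod>k<Suc n. 1 - a * q ^ k) \<longlonglongrightarrow> qpoch_inf a q"
    using qpoch_LIMSEQ[OF assms] by (rule LIMSEQ_Suc)
  also have "(\<lambda>n. \<Prod>k<Suc n. 1 - a * q ^ k) = (\<lambda>n. (1 - a) * (\<Prod>k<n. 1 - (a * q) * q ^ k))"
    by (subst prod.lessThan_Suc_shift) (simp add: mult_ac)
  finally have "(\<lambda>n. (1 - a) * (\<Prod>k<n. 1 - (a * q) * q ^ k)) \<longlonglongrightarrow> qpoch_inf a q" .
  moreover have "(\<lambda>n. (1 - a) * (\<Prod>k<n. 1 - (a * q) * q ^ k)) \<longlonglongrightarrow> (1 - a) * qpoch_inf (a * q) q"
    by (intro tendsto_intros qpoch_LIMSEQ assms)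
  ultimately show ?thesis
    by (rule LIMSEQ_unique)
qed

lemma qpoch_inf_nonzero:
  assumes "norm q < 1" "\<And>k. a * q ^ k \<noteq> 1"
  shows "qpoch_inf a q \<noteq> 0"
  unfolding qpoch_inf_def using assms
  by (intro prodinf_nonzero convergent_prod_qpoch) auto

lemma qpoch_inf_nonzero':
  assumes "norm q < 1" "norm a < 1"
  shows "qpoch_inf a q \<noteq> 0"
proof (rule qpoch_inf_nonzero)
  fix k
  have "norm a * norm q ^ k \<le> norm a * 1"
    using assms by (intro mult_left_mono power_le_one) auto
  hence "norm (a * q ^ k) < 1"
    using assms by (simp add: norm_mult norm_power)
  thus "a * q ^ k \<noteq> 1"
    by auto
qed (use assms in auto)

lemma uniform_limit_qpoch:
  fixes f g :: "'a :: topological_space \<Rightarrow> complex"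
  assumes "compact K" "continuous_on K f" "continuous_on K g" "\<And>z. z \<in> K \<Longrightarrow> norm (g z) < 1"
  shows "uniform_limit K (\<lambda>n z. \<Prod>k<n. 1 - f z * g z ^ k) (\<lambda>z. qpoch_inf (f z) (g z)) sequentially"
proof (cases "K = {}")
  case False
  have "\<exists>x\<in>K. \<forall>y\<in>K. norm (f y) \<le> norm (f x)"
    by (intro continuous_attains_sup continuous_intros assms False)
  then obtain C where C: "\<And>z. z \<in> K \<Longrightarrow> norm (f z) \<le> C"
    by auto
  have "\<exists>x\<in>K. \<forall>y\<in>K. norm (g y) \<le> norm (g x)"
    by (intro continuous_attains_sup continuous_intros assms False)
  then obtain z0 where z0: "z0 \<in> K" "\<And>z. z \<in> K \<Longrightarrow> norm (g z) \<le> norm (g z0)"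
    by auto
  have "uniformly_convergent_on K (\<lambda>n z. \<Prod>k<n. 1 - f z * g z ^ k)"
  proof (rule uniformly_convergent_on_prod'[OF _ assms(1)])
    show "continuous_on K (\<lambda>x. 1 - f x * g x ^ n)" for n
      by (intro continuous_intros assms)
    show "uniformly_convergent_on K (\<lambda>N x. \<Sum>n<N. norm (1 - f x * g x ^ n - 1))"
    proof (rule Weierstrass_m_test')
      fix n z assume "z \<in> K"
      have "norm (f z) * norm (g z) ^ n \<le> C * norm (g z0) ^ n"
        using C[OF \<open>z \<in> K\<close>] z0(2)[OF \<open>z \<in> K\<close>]
        by (intro mult_mono power_mono order.trans[OF norm_ge_zero C[OF \<open>z \<in> K\<close>]]) auto
      thus "norm (norm (1 - f z * g z ^ n - 1)) \<le> C * norm (g z0) ^ n"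
        by (simp add: norm_mult norm_power)
    next
      show "summable (\<lambda>n. C * norm (g z0) ^ n)"
        using assms(4)[OF z0(1)] by (intro summable_mult summable_geometric) auto
    qed
  qed
  then obtain l where l: "uniform_limit K (\<lambda>n z. \<Prod>k<n. 1 - f z * g z ^ k) l sequentially"
    by (auto simp: uniformly_convergent_on_def)
  have "l z = qpoch_inf (f z) (g z)" if "z \<in> K" for z
    using LIMSEQ_unique[OF tendsto_uniform_limitI[OF l that] qpoch_LIMSEQ] assms(4)[OF that]
    by blast
  with l show ?thesis
    by (simp cong: uniform_limit_cong')
qed auto

lemma holomorphic_qpoch [holomorphic_intros]:
  assumes "open S" "f holomorphic_on S" "g holomorphic_on S" "\<And>z. z \<in> S \<Longrightarrow> norm (g z) < 1"
  shows "(\<lambda>z. qpoch_inf (f z) (g z)) holomorphic_on S"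
proof (rule holomorphic_uniform_sequence[OF assms(1)])
  show "(\<lambda>z. \<Prod>k<n. 1 - f z * g z ^ k) holomorphic_on S" for n
    by (intro holomorphic_intros assms)
  fix x assume "x \<in> S"
  then obtain d where d: "d > 0" "cball x d \<subseteq> S"
    using assms(1) open_contains_cball by blast
  have "uniform_limit (cball x d) (\<lambda>n z. \<Prod>k<n. 1 - f z * g z ^ k) (\<lambda>z. qpoch_inf (f z) (g z)) sequentially"
    using d by (intro uniform_limit_qpoch holomorphic_on_imp_continuous_on holomorphic_on_subset[OF assms(2)]
        holomorphic_on_subset[OF assms(3)] assms(4)) auto
  with d show "\<exists>d. 0 < d \<and> cball x d \<subseteq> S \<and>
      uniform_limit (cball x d) (\<lambda>n z. \<Prod>k<n. 1 - f z * g z ^ k) (\<lambda>z. qpoch_inf (f z) (g z)) sequentially"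
    by blast
qed

definition euler :: "complex \<Rightarrow> complex" where
  "euler q = qpoch_inf q q"

lemma euler_nonzero: "norm q < 1 \<Longrightarrow> euler q \<noteq> 0"
  by (simp add: euler_def qpoch_inf_nonzero')

lemma holomorphic_euler [holomorphic_intros]:
  assumes "open S" "f holomorphic_on S" "\<And>z. z \<in> S \<Longrightarrow> norm (f z) < 1"
  shows "(\<lambda>z. euler (f z)) holomorphic_on S"
  unfolding euler_def by (intro holomorphic_intros assms)

lemma euler_LIMSEQ:
  assumes "norm q < 1"
  shows "(\<lambda>n. \<Prod>k=1..n. 1 - q ^ k) \<longlonglongrightarrow> euler q"
proof -
  have "(\<Prod>k=1..n. 1 - q ^ k) = (\<Prod>k<n. 1 - q * q ^ k)" for n
    by (induction n) simp_all
  thus ?thesis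
    using qpoch_LIMSEQ[OF assms, of q] by (simp add: euler_def)
qed

lemma prod_atMost_add5:
  fixes f :: "nat \<Rightarrow> 'a :: comm_monoid_mult"
  shows "(\<Prod>k=1..n+5. f k) = (\<Prod>k=1..n. f k) * (f (n+1) * f (n+2) * f (n+3) * f (n+4) * f (n+5))"
  by (simp add: numeral_eq_Suc mult_ac)

lemma euler_quintisection:
  assumes "norm q < 1"
  shows "euler q = euler (q ^ 5) * qpoch_inf q (q ^ 5) * qpoch_inf (q ^ 2) (q ^ 5) *
           qpoch_inf (q ^ 3) (q ^ 5) * qpoch_inf (q ^ 4) (q ^ 5)"
proof -
  have q5: "norm (q ^ 5) < 1"
    using assms using power_strict_decreasing[of 0 5 "norm q"] by (cases "q = 0") (auto simp: norm_power)
  have fin: "(\<Prod>k=1..5*n. 1 - q ^ k) = (\<Prod>k<n. 1 - q ^ 5 * (q ^ 5) ^ k) * (\<Prod>k<n. 1 - q * (q ^ 5) ^ k) *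
     (\<Prod>k<n. 1 - q ^ 2 * (q ^ 5) ^ k) * (\<Prod>k<n. 1 - q ^ 3 * (q ^ 5) ^ k) * (\<Prod>k<n. 1 - q ^ 4 * (q ^ 5) ^ k)" for n
  proof (induction n)
    case (Suc n)
    have e: "q ^ i * (q ^ 5) ^ n = q ^ (5 * n + i)" for i
      by (simp only: power_add power_mult[of q 5 n] mult.commute[of "q ^ i"])
    have e1: "q * (q ^ 5) ^ n = q ^ (5 * n + 1)"
      using e[of 1] by simp
    have "(\<Prod>k=1..5*Suc n. 1 - q ^ k) = (\<Prod>k=1..5*n. 1 - q ^ k) * ((1 - q ^ (5*n+1)) * (1 - q ^ (5*n+2)) *
        (1 - q ^ (5*n+3)) * (1 - q ^ (5*n+4)) * (1 - q ^ (5*n+5)))"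
      using prod_atMost_add5[of "\<lambda>k. 1 - q ^ k" "5 * n"] by (simp add: add.commute)
    also have "\<dots> = (\<Prod>k<Suc n. 1 - q ^ 5 * (q ^ 5) ^ k) * (\<Prod>k<Suc n. 1 - q * (q ^ 5) ^ k) *
     (\<Prod>k<Suc n. 1 - q ^ 2 * (q ^ 5) ^ k) * (\<Prod>k<Suc n. 1 - q ^ 3 * (q ^ 5) ^ k) * (\<Prod>k<Suc n. 1 - q ^ 4 * (q ^ 5) ^ k)"
      unfolding Suc.IH by (simp only: prod.lessThan_Suc e e1 mult_ac)
    finally show ?case .
  qed auto
  have "filterlim (\<lambda>n::nat. 5 * n) sequentially sequentially"
    by (rule mult_nat_left_at_top) auto
  from filterlim_compose[OF euler_LIMSEQ[OF assms] this]
  have "(\<lambda>n. \<Prod>k=1..5*n. 1 - q ^ k) \<longlonglongrightarrow> euler q" .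
  moreover have "(\<lambda>n. \<Prod>k=1..5*n. 1 - q ^ k) \<longlonglongrightarrow> qpoch_inf (q ^ 5) (q ^ 5) * qpoch_inf q (q ^ 5) * qpoch_inf (q ^ 2) (q ^ 5) *
           qpoch_inf (q ^ 3) (q ^ 5) * qpoch_inf (q ^ 4) (q ^ 5)"
    unfolding fin by (intro tendsto_mult qpoch_LIMSEQ q5)
  ultimately show ?thesis
    unfolding euler_def by (rule LIMSEQ_unique)
qed

subsection \<open>Differences of Weierstrass functions as theta quotients\<close>

definition lambert2 :: "complex \<Rightarrow> complex \<Rightarrow> complex" where
  "lambert2 Q x = (\<Sum>n. of_nat n / (1 - Q ^ n) * x ^ n)"

lemma sums_nat_power:
  fixes x :: "'a :: {real_normed_field, banach}"
  assumes "norm x < 1"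
  shows "(\<lambda>n. of_nat n * x ^ n) sums (x / (1 - x)\<^sup>2)"
proof -
  have "(\<lambda>n. x * (of_nat (Suc n) * x ^ n)) sums (x * (1 / (1 - x)\<^sup>2))"
    by (intro sums_mult geometric_deriv_sums assms)
  hence "(\<lambda>n. of_nat (Suc n) * x ^ Suc n) sums (x / (1 - x)\<^sup>2)"
    by (simp add: mult_ac)
  from sums_Suc_imp[OF _ this] show ?thesis
    by simp
qed

lemma summable_lambert2:
  assumes "norm Q < 1" "norm x < 1"
  shows "summable (\<lambda>n. of_nat n / (1 - Q ^ n) * x ^ n :: complex)"
proof (rule summable_comparison_test')
  show "summable (\<lambda>n. (of_nat n * norm x ^ n) / (1 - norm Q))"
    using sums_nat_power[of "norm x"] assms by (intro summable_divide) (auto simp: sums_iff)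
next
  fix n :: nat assume "n \<ge> 0"
  show "norm (of_nat n / (1 - Q ^ n) * x ^ n) \<le> (of_nat n * norm x ^ n) / (1 - norm Q)"
  proof (cases "n = 0")
    case False
    have "norm Q ^ n \<le> norm Q ^ 1"
      using assms False by (intro power_decreasing) auto
    moreover have "1 - norm (Q ^ n) \<le> norm (1 - Q ^ n)"
      using norm_triangle_ineq2[of 1 "Q ^ n"] by simp
    ultimately have "1 - norm Q \<le> norm (1 - Q ^ n)"
      by (simp add: norm_power)
    hence "of_nat n * norm x ^ n / norm (1 - Q ^ n) \<le> of_nat n * norm x ^ n / (1 - norm Q)"
      using assms by (intro divide_left_mono mult_pos_pos) auto
    thus ?thesis
      by (simp add: norm_mult norm_divide norm_power)
  qed auto
qed

lemma holomorphic_lambert2 [holomorphic_intros]: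
  assumes "norm Q < 1" "f holomorphic_on S" "\<And>z. z \<in> S \<Longrightarrow> norm (f z) < 1"
  shows "(\<lambda>z. lambert2 Q (f z)) holomorphic_on S"
proof -
  define F where "F = Abs_fps (\<lambda>n. of_nat n / (1 - Q ^ n))"
  have "fps_conv_radius F \<ge> 1"
    unfolding fps_conv_radius_def
  proof (rule conv_radius_geI_ex)
    fix r :: real assume r: "0 < r" "ereal r < 1"
    have "summable (\<lambda>n. fps_nth F n * of_real r ^ n)"
      using r summable_lambert2[OF assms(1), of "of_real r"] by (simp add: F_def)
    thus "\<exists>z. norm z = r \<and> summable (\<lambda>n. fps_nth F n * z ^ n)"
      using r by (intro exI[of _ "of_real r"]) auto
  qed
  hence "eval_fps F holomorphic_on ball 0 1"
    by (intro holomorphic_on_eval_fps) (auto intro!: less_le_trans[of _ 1 "fps_conv_radius F"])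
  hence "lambert2 Q holomorphic_on ball 0 1"
    by (simp add: eval_fps_def[abs_def] lambert2_def[abs_def] F_def)
  moreover have "f ` S \<subseteq> ball 0 1"
    using assms(3) by auto
  ultimately show ?thesis
    using holomorphic_on_compose_gen[OF assms(2)] by (auto simp: o_def)
qed

lemma lambert2_shift:
  assumes "norm Q < 1" "norm x < 1"
  shows "lambert2 Q x = x / (1 - x)\<^sup>2 + lambert2 Q (x * Q)"
proof -
  have Qx: "norm (x * Q) < 1"
    using assms mult_strict_mono'[of "norm x" 1 "norm Q" 1] by (simp add: norm_mult)
  have "lambert2 Q x - lambert2 Q (x * Q) =
      (\<Sum>n. of_nat n / (1 - Q ^ n) * x ^ n - of_nat n / (1 - Q ^ n) * (x * Q) ^ n)"
    unfolding lambert2_def by (intro suminf_diff summable_lambert2 assms Qx)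
  also have "(\<lambda>n. of_nat n / (1 - Q ^ n) * x ^ n - of_nat n / (1 - Q ^ n) * (x * Q) ^ n) = (\<lambda>n. of_nat n * x ^ n)"
  proof
    fix n
    show "of_nat n / (1 - Q ^ n) * x ^ n - of_nat n / (1 - Q ^ n) * (x * Q) ^ n = of_nat n * x ^ n"
    proof (cases "n = 0")
      case False
      hence "norm Q ^ n < 1"
        using assms power_less_one_iff[of "norm Q" n] by simp
      hence "Q ^ n \<noteq> 1"
        using norm_power[of Q n] by force
      have "d * x ^ n - d * (x * Q) ^ n = d * (1 - Q ^ n) * x ^ n" for d
        by (simp add: algebra_simps power_mult_distrib)
      from this[of "of_nat n / (1 - Q ^ n)"] show ?thesis
        using \<open>Q ^ n \<noteq> 1\<close> by simp
    qed auto
  qed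
  also have "(\<Sum>n. of_nat n * x ^ n) = x / (1 - x)\<^sup>2"
    using sums_nat_power[OF assms(2)] by (simp add: sums_iff)
  finally show ?thesis
    by (simp add: algebra_simps)
qed

definition theta :: "complex \<Rightarrow> complex \<Rightarrow> complex" where
  "theta Q z = qpoch_inf z Q * qpoch_inf (Q / z) Q"

definition theta' :: "complex \<Rightarrow> complex \<Rightarrow> complex" where
  "theta' Q z = qpoch_inf (z * Q) Q * qpoch_inf (Q / z) Q"

lemma theta_altdef: "norm Q < 1 \<Longrightarrow> theta Q z = (1 - z) * theta' Q z"
  by (simp add: theta_def theta'_def qpoch_inf_rec[of Q z])

lemma theta'_inverse: "theta' Q (1 / z) = theta' Q z"
  by (simp add: theta'_def mult_ac)

lemma theta_inverse: "norm Q < 1 \<Longrightarrow> z \<noteq> 0 \<Longrightarrow> theta Q (1 / z) = - theta Q z / z"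
  by (simp add: theta_altdef theta'_inverse field_simps)

lemma theta_flip: "Q \<noteq> 0 \<Longrightarrow> theta Q (Q / z) = theta Q z"
  by (simp add: theta_def mult_ac)

lemma theta_mult: "norm Q < 1 \<Longrightarrow> Q \<noteq> 0 \<Longrightarrow> z \<noteq> 0 \<Longrightarrow> theta Q (z * Q) = - theta Q z / z"
  using theta_flip[of Q "1 / z"] theta_inverse[of Q z] by (simp add: mult_ac)

lemma holomorphic_theta [holomorphic_intros]:
  assumes "open S" "norm Q < 1" "f holomorphic_on S" "\<And>z. z \<in> S \<Longrightarrow> f z \<noteq> 0"
  shows "(\<lambda>z. theta Q (f z)) holomorphic_on S" "(\<lambda>z. theta' Q (f z)) holomorphic_on S"
  unfolding theta_def theta'_def by (intro holomorphic_intros assms; simp add: assms)+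

definition annulus :: "complex \<Rightarrow> complex set" where
  "annulus Q = {z. norm Q < norm z \<and> norm (z * Q) < 1}"

lemma open_annulus: "open (annulus Q)"
  unfolding annulus_def by (intro open_Collect_conj open_Collect_less continuous_intros)

lemma annulus_altdef:
  assumes "Q \<noteq> 0"
  shows "annulus Q = {z. norm Q < norm (z - 0) \<and> norm (z - 0) < 1 / norm Q}"
  using assms by (auto simp: annulus_def norm_mult field_simps)

lemma connected_ann: "Q \<noteq> 0 \<Longrightarrow> connected (annulus Q)"
  unfolding annulus_altdef by (rule connected_annulus) auto

lemma annulusD:
  assumes "z \<in> annulus Q"
  shows "z \<noteq> 0" "norm (z * Q) < 1" "norm (Q / z) < 1"
proof -
  show [simp]: "z \<noteq> 0" and "norm (z * Q) < 1"
    using assms by (auto simp: annulus_def)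
  have "norm Q < norm z"
    using assms by (auto simp: annulus_def)
  thus "norm (Q / z) < 1"
    by (simp add: norm_divide)
qed

lemma theta'_nonzero:
  assumes "norm Q < 1" "z \<in> annulus Q"
  shows "theta' Q z \<noteq> 0"
  using assms annulusD[OF assms(2)] by (simp add: theta'_def qpoch_inf_nonzero')

lemma theta_nonzero:
  assumes "norm Q < 1" "z \<in> annulus Q" "z \<noteq> 1"
  shows "theta Q z \<noteq> 0"
  using theta'_nonzero[OF assms(1,2)] assms by (simp add: theta_altdef)

text \<open>
  The closed annulus \<open>|Q| s \<le> |z| \<le> s\<close> is a fundamental domain for multiplication by \<open>Q\<close>, so a
  \<open>Q\<close>-periodic function attains its maximum modulus.
\<close>
lemma periodic_annulus_constant:
  assumes Q: "norm Q < 1" "Q \<noteq> 0"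
  assumes h: "h holomorphic_on annulus Q"
  assumes per: "\<And>z. 1 < norm z \<Longrightarrow> norm (z * Q) < 1 \<Longrightarrow> h (z * Q) = h z"
  shows "h constant_on annulus Q"
proof -
  have "1 < 1 / norm Q"
    using Q by simp
  then obtain s where s: "1 < s" "s < 1 / norm Q"
    using dense by blast
  have sQ: "norm Q * s < 1"
    using s Q by (simp add: field_simps)
  define K where "K = cball 0 s - ball (0::complex) (norm Q * s)"
  have sub: "K \<subseteq> annulus Q"
  proof
    fix z assume "z \<in> K"
    hence z: "norm z \<le> s" "norm Q * s \<le> norm z"
      by (auto simp: K_def)
    have "norm z * norm Q \<le> s * norm Q"
      using z by (intro mult_right_mono) auto
    moreover have "norm Q * 1 < norm Q * s"
      using Q s by (intro mult_strict_left_mono) auto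
    ultimately show "z \<in> annulus Q"
      using z sQ by (auto simp: annulus_def norm_mult mult_ac)
  qed
  have "1 \<in> K"
    using s sQ by (auto simp: K_def)
  have "compact K"
    unfolding K_def by (intro compact_diff) auto
  moreover have "continuous_on K (\<lambda>z. norm (h z))"
    by (intro continuous_intros holomorphic_on_imp_continuous_on holomorphic_on_subset[OF h] sub)
  ultimately obtain z0 where z0: "z0 \<in> K" "\<And>z. z \<in> K \<Longrightarrow> norm (h z) \<le> norm (h z0)"
    using continuous_attains_sup[of K "\<lambda>z. norm (h z)"] \<open>1 \<in> K\<close> by blast
  show ?thesis
  proof (rule maximum_modulus_principle[OF h])
    show "z0 \<in> annulus Q"
      using z0 sub by auto
    fix z assume z: "z \<in> annulus Q"
    consider "norm z > s" | "norm z < norm Q * s" | "z \<in> K"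
      by (force simp: K_def)
    thus "norm (h z) \<le> norm (h z0)"
    proof cases
      case 1
      hence "h (z * Q) = h z"
        using z s by (intro per) (auto simp: annulus_def)
      moreover have "z * Q \<in> K"
        using 1 z s Q mult_strict_left_mono[of s "norm z" "norm Q"]
        by (auto simp: annulus_def K_def norm_mult mult_ac)
      ultimately show ?thesis
        using z0(2)[of "z * Q"] by simp
    next
      case 2
      hence "h (z / Q * Q) = h (z / Q)" 
        using z Q s sQ by (intro per) (auto simp: annulus_def norm_divide norm_mult field_simps)
      moreover have "norm Q * s * norm Q \<le> 1 * norm Q"
        using sQ by (intro mult_right_mono) auto
      hence "norm Q * s * norm Q < norm z"
        using z by (simp only: annulus_def mem_Collect_eq) linarith
      hence "z / Q \<in> K"
        using Q 2 by (auto simp: K_def norm_divide field_simps)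
      ultimately show ?thesis
        using z0(2)[of "z / Q"] Q by simp
    qed (use z0 in auto)
  qed (use open_annulus connected_ann Q in auto)
qed

lemma holomorphic_double_zero:
  assumes "open S" "k holomorphic_on S" "c \<in> S" "k c = 0" "deriv k c = 0"
  obtains g where "g holomorphic_on S" "\<And>z. z \<in> S \<Longrightarrow> k z = (z - c)\<^sup>2 * g z"
proof -
  define f where "f = (\<lambda>z. if z = c then 0 else k z / (z - c))"
  have f: "f holomorphic_on S"
    by (rule pole_theorem_open_0[OF assms(2,1), of c]) (auto simp: f_def assms)
  define g where "g = (\<lambda>z. if z = c then deriv f c else f z / (z - c))"
  have "g holomorphic_on S"
    by (rule pole_theorem_open_0[OF f assms(1), of c]) (auto simp: g_def f_def)
  moreover have "k z = (z - c)\<^sup>2 * g z" for z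
    by (auto simp: g_def f_def assms(4) power2_eq_square)
  ultimately show thesis
    using that by blast
qed

definition eis2 :: "complex \<Rightarrow> complex \<Rightarrow> complex" where
  "eis2 Q a = a / (1 - a)\<^sup>2 + lambert2 Q (a * Q) + lambert2 Q (Q / a)"

lemma eis2_periodic:
  assumes "norm Q < 1" "Q \<noteq> 0" "1 < norm a" "norm (a * Q) < 1"
  shows "eis2 Q (a * Q) = eis2 Q a"
proof -
  have [simp]: "a \<noteq> 0"
    using assms by auto
  have "eis2 Q a - eis2 Q (a * Q) = a / (1 - a)\<^sup>2 - (1 / a) / (1 - 1 / a)\<^sup>2"
    using lambert2_shift[OF assms(1,4)] lambert2_shift[OF assms(1), of "1 / a"] assms
    by (simp add: eis2_def norm_divide)
  also have "(1 / a) / (1 - 1 / a)\<^sup>2 = a / (1 - a)\<^sup>2"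
    using assms by (auto simp: divide_simps) (auto simp: algebra_simps power2_eq_square)
  finally show ?thesis
    by simp
qed

text \<open>
  The function \<open>K\<close> below satisfies \<open>K (1 / z) = K z\<close> and so has a double zero at 1; therefore the difference of the
  two sides extends to a holomorphic \<open>Q\<close>-periodic function. It is constant, and it vanishes at \<open>b\<close>.
\<close>
theorem eis2_diff:
  assumes Q: "norm Q < 1" "Q \<noteq> 0"
  assumes a: "a \<in> annulus Q" "a \<noteq> 1" and b: "b \<in> annulus Q" "b \<noteq> 1"
  shows "eis2 Q a - eis2 Q b =
           a * qpoch_inf Q Q ^ 4 * theta Q (a * b) * theta Q (b / a) / ((theta Q a)\<^sup>2 * (theta Q b)\<^sup>2)"
proof -
  define A where "A = annulus Q"
  define q where "q = qpoch_inf Q Q"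
  define K where "K = (\<lambda>a. (theta' Q a)\<^sup>2 * (theta Q b)\<^sup>2 *
      ((1 - a)\<^sup>2 / a * (lambert2 Q (a * Q) + lambert2 Q (Q / a) - eis2 Q b) + 1)
      - q ^ 4 * theta Q (a * b) * theta Q (b / a))"
  have "open A"
    by (simp add: A_def open_annulus)
  have A: "z \<noteq> 0" "norm (z * Q) < 1" "norm (Q / z) < 1" if "z \<in> A" for z
    using annulusD[of z Q] that by (auto simp: A_def)
  have "1 \<in> A"
    using Q by (auto simp: A_def annulus_def)
  have [simp]: "b \<noteq> 0"
    using b annulusD(1) by auto
  have hK: "K holomorphic_on A"
    unfolding K_def by (intro holomorphic_intros \<open>open A\<close> Q; (simp add: A)?)
  have K1: "K 1 = 0"
    by (simp add: K_def theta'_def q_def power2_eq_square power4_eq_xxxx)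
  have Kinv: "K (1 / z) = K z" if "z \<in> A" for z
    using A(1)[OF that]
    by (simp add: K_def theta'_inverse theta_inverse Q mult_ac add_ac)
       (simp add: divide_simps, simp add: algebra_simps power2_eq_square)
  have "deriv K 1 = 0"
  proof -
    have dK: "(K has_field_derivative deriv K 1) (at 1)"
      using hK \<open>open A\<close> \<open>1 \<in> A\<close> by (simp add: holomorphic_derivI)
    have "((\<lambda>z. K (1 / z)) has_field_derivative deriv K 1 * (-1)) (at 1)"
      by (rule DERIV_chain2[of K]) (use dK in \<open>auto intro!: derivative_eq_intros\<close>)
    moreover have "\<forall>\<^sub>F z in nhds 1. K (1 / z) = K z"
      using eventually_nhds_in_open[OF \<open>open A\<close> \<open>1 \<in> A\<close>] by eventually_elim (rule Kinv)
    ultimately have "(K has_field_derivative deriv K 1 * (-1)) (at 1)"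
      by (subst (asm) DERIV_cong_ev) auto
    from DERIV_unique[OF dK this] show ?thesis
      by (simp add: eq_neg_iff_add_eq_0)
  qed
  then obtain g where g: "g holomorphic_on A" "\<And>z. z \<in> A \<Longrightarrow> K z = (z - 1)\<^sup>2 * g z"
    using holomorphic_double_zero[OF \<open>open A\<close> hK \<open>1 \<in> A\<close> K1] by blast
  define h where "h = (\<lambda>z. z * g z / ((theta' Q z)\<^sup>2 * (theta Q b)\<^sup>2))"
  have nz: "theta' Q z \<noteq> 0" if "z \<in> A" for z
    using theta'_nonzero Q that by (auto simp: A_def)
  have nzb: "theta Q b \<noteq> 0"
    using theta_nonzero Q b by auto
  have hh: "h holomorphic_on A"
    unfolding h_def by (intro holomorphic_intros g \<open>open A\<close> Q; (simp add: A nz nzb)?)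
  have h_eq: "h z = eis2 Q z - eis2 Q b - z * q ^ 4 * theta Q (z * b) * theta Q (b / z) / ((theta Q z)\<^sup>2 * (theta Q b)\<^sup>2)"
    if "z \<in> A" "z \<noteq> 1" for z
  proof -
    have "h z = z * ((z - 1)\<^sup>2 * g z) / ((theta Q z)\<^sup>2 * (theta Q b)\<^sup>2)"
      using that nz[of z] nzb by (simp add: h_def theta_altdef Q power_mult_distrib power2_commute[of 1 z])
    also have "(z - 1)\<^sup>2 * g z = K z"
      using g(2) that by simp
    also have "z * K z = (theta Q z)\<^sup>2 * (theta Q b)\<^sup>2 * (eis2 Q z - eis2 Q b) - z * q ^ 4 * theta Q (z * b) * theta Q (b / z)"
    proof -
      define w where "w = (1 - z)\<^sup>2"
      have "w \<noteq> 0"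
        using that by (simp add: w_def)
      moreover have "(theta Q z)\<^sup>2 = w * (theta' Q z)\<^sup>2"
        by (simp add: theta_altdef Q w_def power_mult_distrib)
      ultimately show ?thesis
        using A(1)[OF that(1)] unfolding K_def eis2_def[of Q z] w_def[symmetric]
        by (simp add: field_simps)
    qed
    finally show ?thesis
      using nz[OF that(1)] nzb that(2) by (simp add: theta_altdef[OF Q(1), of z] field_simps)
  qed
  have "h constant_on annulus Q"
  proof (rule periodic_annulus_constant[OF Q])
    show "h holomorphic_on annulus Q"
      using hh by (simp add: A_def)
    fix z assume z: "1 < norm z" "norm (z * Q) < 1"
    hence [simp]: "z \<noteq> 0" by auto
    have "norm Q * 1 < norm Q * norm z"
      using z Q by (intro mult_strict_left_mono) auto
    hence zA: "z \<in> A" "z * Q \<in> A" "z \<noteq> 1"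
      using z Q mult_strict_mono'[of "norm (z * Q)" 1 "norm Q" 1] 
      by (auto simp: A_def annulus_def norm_mult mult_ac)
    have zA': "z * Q \<noteq> 1"
      using z by auto
    have t1: "theta Q (z * Q * b) = - theta Q (z * b) / (z * b)"
      using theta_mult[OF Q, of "z * b"] by (simp add: mult_ac)
    have t2: "theta Q (b / (z * Q)) = - (b / (z * Q)) * theta Q (b / z)"
      using theta_mult[OF Q, of "b / (z * Q)"] Q by (simp add: field_simps)
    show "h (z * Q) = h z"
      unfolding h_eq[OF zA(1,3)] h_eq[OF zA(2) zA'] eis2_periodic[OF Q z] t1 t2 theta_mult[OF Q \<open>z \<noteq> 0\<close>]
      using theta_nonzero[OF Q(1), of z] zA Q nzb 
      by (simp add: A_def field_simps power2_eq_square)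
  qed
  hence "h a = h b"
    using a b unfolding constant_on_def by metis
  moreover have "theta Q 1 = 0"
    by (simp add: theta_altdef Q)
  hence "h b = 0"
    using h_eq[of b] b by (simp add: A_def)
  ultimately show ?thesis
    using h_eq[of a] a by (simp add: A_def q_def)
qed

subsection \<open>The Eisenstein series as products\<close>

lemma sum_up_to_4: "(\<Sum>j=1..4. f j) = f 1 + f 2 + f 3 + f (4::nat)"
  for f :: "nat \<Rightarrow> complex"
  by (simp add: eval_nat_numeral)

lemma L2_sums:
  assumes "norm q < 1"
  shows "(\<lambda>n. of_nat n / (1 - q ^ (5 * n)) * (\<Sum>j=1..4. chi35 j * q ^ (j * n))) sums L2 q"
    and "L2 q = lambert2 (q ^ 5) q - lambert2 (q ^ 5) (q ^ 2) - lambert2 (q ^ 5) (q ^ 3) + lambert2 (q ^ 5) (q ^ 4)"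
proof -
  define t where "t = (\<lambda>n. of_nat n / (1 - q ^ (5 * n)) * (\<Sum>j=1..4. chi35 j * q ^ (j * n)))"
  have *: "norm (q ^ j) < 1" if "j > 0" for j
    using assms that by (simp add: norm_power power_less_one_iff)
  have lam: "(\<lambda>n. of_nat n / (1 - (q ^ 5) ^ n) * (q ^ j) ^ n) sums lambert2 (q ^ 5) (q ^ j)" if "j > 0" for j
    unfolding lambert2_def using that by (intro summable_sums summable_lambert2 *) auto
  have "t = (\<lambda>n. of_nat n / (1 - (q ^ 5) ^ n) * (q ^ 1) ^ n - of_nat n / (1 - (q ^ 5) ^ n) * (q ^ 2) ^ n
      - of_nat n / (1 - (q ^ 5) ^ n) * (q ^ 3) ^ n + of_nat n / (1 - (q ^ 5) ^ n) * (q ^ 4) ^ n)"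
  proof (unfold t_def sum_up_to_4 power_mult, rule ext)
    fix n
    have distrib: "d * (chi35 1 * (q ^ 1) ^ n + chi35 2 * (q ^ 2) ^ n + chi35 3 * (q ^ 3) ^ n + chi35 4 * (q ^ 4) ^ n) =
        d * (q ^ 1) ^ n - d * (q ^ 2) ^ n - d * (q ^ 3) ^ n + d * (q ^ 4) ^ n" for d
      by (simp add: chi35_def algebra_simps)
    show "of_nat n / (1 - (q ^ 5) ^ n) * (chi35 1 * (q ^ 1) ^ n + chi35 2 * (q ^ 2) ^ n + chi35 3 * (q ^ 3) ^ n + chi35 4 * (q ^ 4) ^ n) =
        of_nat n / (1 - (q ^ 5) ^ n) * (q ^ 1) ^ n - of_nat n / (1 - (q ^ 5) ^ n) * (q ^ 2) ^ n
      - of_nat n / (1 - (q ^ 5) ^ n) * (q ^ 3) ^ n + of_nat n / (1 - (q ^ 5) ^ n) * (q ^ 4) ^ n"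
      by (rule distrib)
  qed
  moreover have "\<dots> sums (lambert2 (q ^ 5) (q ^ 1) - lambert2 (q ^ 5) (q ^ 2) - lambert2 (q ^ 5) (q ^ 3) + lambert2 (q ^ 5) (q ^ 4))"
    by (intro sums_add sums_diff lam) auto
  ultimately have t: "t sums (lambert2 (q ^ 5) q - lambert2 (q ^ 5) (q ^ 2) - lambert2 (q ^ 5) (q ^ 3) + lambert2 (q ^ 5) (q ^ 4))"
    by simp
  have "L2 q = (\<Sum>n. t (Suc n))"
    by (simp add: L2_def t_def)
  also have "\<dots> = suminf t - t 0"
    using t by (intro suminf_split_head) (auto simp: sums_iff)
  also have "t 0 = 0"
    by (simp add: t_def)
  finally have "L2 q = suminf t"
    by simp
  with t show "L2 q = lambert2 (q ^ 5) q - lambert2 (q ^ 5) (q ^ 2) - lambert2 (q ^ 5) (q ^ 3) + lambert2 (q ^ 5) (q ^ 4)"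
    "(\<lambda>n. of_nat n / (1 - q ^ (5 * n)) * (\<Sum>j=1..4. chi35 j * q ^ (j * n))) sums L2 q"
    by (auto simp: sums_iff t_def)
qed

theorem L2_eq_euler:
  assumes "norm q < 1"
  shows "L2 q = q * euler (q ^ 5) ^ 5 / euler q"
proof (cases "q = 0")
  case True
  thus ?thesis
    using L2_sums(2)[OF assms] by simp
next
  case False
  define Q where "Q = q ^ 5"
  have pw: "norm (q ^ j) < 1" if "j > 0" for j
    using assms that by (simp add: norm_power power_less_one_iff)
  have Q: "norm Q < 1" "Q \<noteq> 0"
    using False pw[of 5] by (auto simp: Q_def)
  have less: "norm q ^ i < norm q ^ j" if "j < i" for i j
    using that False assms by (intro power_strict_decreasing) auto
  have ann: "q \<in> annulus Q" "q ^ 2 \<in> annulus Q"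
    using less[of 1 5] less[of 2 5] less[of 0 6] less[of 0 7]
    by (simp_all add: annulus_def Q_def norm_power flip: power_add power_Suc)
  have ne: "q \<noteq> 1" "q ^ 2 \<noteq> 1"
    using pw[of 1] pw[of 2] by auto
  have quot: "Q / q = q ^ 4" "Q / q ^ 2 = q ^ 3"
    using False by (simp_all add: Q_def power_eq_if)
  have "L2 q = eis2 Q q - eis2 Q (q ^ 2)"
    using lambert2_shift[OF Q(1), of q] lambert2_shift[OF Q(1), of "q ^ 2"] pw[of 1] pw[of 2] L2_sums(2)[OF assms]
    by (simp add: eis2_def quot Q_def[symmetric])
  also have "\<dots> = q * euler Q ^ 4 * theta Q (q * q\<^sup>2) * theta Q (q\<^sup>2 / q) / ((theta Q q)\<^sup>2 * (theta Q (q\<^sup>2))\<^sup>2)"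
    unfolding euler_def by (rule eis2_diff[OF Q ann(1) ne(1) ann(2) ne(2)])
  also have "q\<^sup>2 / q = q"
    using False by (simp add: power2_eq_square)
  also have "theta Q (q * q\<^sup>2) = theta Q (q\<^sup>2)"
    using theta_flip[OF Q(2), of "q ^ 2"] quot by (simp flip: power_Suc)
  also have "q * euler Q ^ 4 * theta Q (q\<^sup>2) * theta Q q / ((theta Q q)\<^sup>2 * (theta Q (q\<^sup>2))\<^sup>2) =
      q * euler Q ^ 5 / (euler Q * theta Q q * theta Q (q\<^sup>2))"
    using theta_nonzero[OF Q(1) ann(1) ne(1)] theta_nonzero[OF Q(1) ann(2) ne(2)] euler_nonzero[OF Q(1)]
    by (simp add: divide_simps) (simp add: power2_eq_square eval_nat_numeral)
  also have "euler Q * theta Q q * theta Q (q\<^sup>2) = euler q"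
    unfolding euler_quintisection[OF assms] by (simp add: theta_def quot Q_def[symmetric] mult_ac)
  finally show ?thesis
    by (simp add: Q_def)
qed

definition zeta5 :: complex where
  "zeta5 = exp (2 * of_real pi * \<i> * of_nat 1 / of_nat 5)"

lemma zeta5_power: "zeta5 ^ n = exp (2 * of_real pi * \<i> * of_nat n / of_nat 5)"
  unfolding zeta5_def by (subst exp_of_nat_mult [symmetric]) (simp add: mult_ac)

lemma zeta5_power_eq_1_iff: "zeta5 ^ n = 1 \<longleftrightarrow> 5 dvd n"
  unfolding zeta5_power by (rule complex_root_unity_eq_1) auto

lemma zeta5_power_mod: "zeta5 ^ (n mod 5) = zeta5 ^ n"
  unfolding zeta5_power by (subst complex_root_unity_eq) auto

lemma norm_zeta5 [simp]: "norm zeta5 = 1"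
  by (simp add: zeta5_def)

lemma root_unity5_sum:
  fixes v :: complex
  assumes "v ^ 5 = 1" "v \<noteq> 1"
  shows "v ^ 4 = - 1 - v - v\<^sup>2 - v ^ 3"
proof -
  have "(v - 1) * (v ^ 4 + v ^ 3 + v\<^sup>2 + v + 1) = v ^ 5 - 1"
    by (simp add: algebra_simps eval_nat_numeral)
  hence "v ^ 4 + v ^ 3 + v\<^sup>2 + v + 1 = 0"
    using assms by simp
  thus ?thesis
    by (simp add: algebra_simps) (metis add.commute add_eq_0_iff)
qed

lemma lessThan_5: "{..<5::nat} = {0,1,2,3,4}"
  by auto

lemma prod_root_unity5:
  fixes v x :: complex
  assumes "v ^ 5 = 1" "v \<noteq> 1"
  shows "(\<Prod>i<5. 1 - v ^ i * x) = 1 - x ^ 5"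
proof -
  have "(\<Prod>i<5. 1 - v ^ i * x) = (1 - x) * (1 - v * x) * (1 - v\<^sup>2 * x) * (1 - v ^ 3 * x) * (1 - v ^ 4 * x)"
    by (simp add: lessThan_5 mult_ac)
  also have "\<dots> = 1 - x ^ 5"
    using root_unity5_sum[OF assms] assms(1) by algebra
  finally show ?thesis .
qed

lemma prod_zeta5:
  "(\<Prod>i<5. 1 - (zeta5 ^ i * q) ^ n) = (if 5 dvd n then (1 - q ^ n) ^ 5 else 1 - (q ^ n) ^ 5)"
proof -
  have *: "(zeta5 ^ i * q) ^ n = (zeta5 ^ n) ^ i * q ^ n" for i
    by (simp add: power_mult_distrib mult.commute flip: power_mult)
  have "(zeta5 ^ n) ^ 5 = 1"
    by (simp add: zeta5_power_eq_1_iff flip: power_mult)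
  thus ?thesis
    unfolding * using prod_root_unity5[of "zeta5 ^ n" "q ^ n"] zeta5_power_eq_1_iff[of n] by auto
qed

lemma norm_zeta5_mult: "norm (zeta5 ^ i * q) = norm q"
  by (simp add: norm_mult norm_power)

lemma prod_euler_zeta5:
  assumes "norm q < 1"
  shows "(\<Prod>i<5. euler (zeta5 ^ i * q)) * euler (q ^ 25) = euler (q ^ 5) ^ 6"
proof -
  define P where "P = (\<lambda>M q. \<Prod>k=1..M. 1 - q ^ k :: complex)"
  have pw: "norm (q ^ j) < 1" if "j > 0" for j
    using assms that by (simp add: norm_power power_less_one_iff)
  have P: "(\<lambda>M. P M x) \<longlonglongrightarrow> euler x" "(\<lambda>M. P (5 * M) x) \<longlonglongrightarrow> euler x" if "norm x < 1" for x
    using euler_LIMSEQ[OF that] filterlim_compose[OF euler_LIMSEQ[OF that] mult_nat_left_at_top[of 5]]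
    by (simp_all only: P_def)
  have fin: "(\<Prod>i<5. P (5 * M) (zeta5 ^ i * q)) * P M (q ^ 25) = P (5 * M) (q ^ 5) * P M (q ^ 5) ^ 5" for M
  proof -
    have "(\<Prod>i<5. P (5 * M) (zeta5 ^ i * q)) =
        (\<Prod>k=1..5*M. if 5 dvd k then (1 - q ^ k) ^ 5 else 1 - (q ^ k) ^ 5)"
      unfolding P_def by (subst prod.swap) (simp only: prod_zeta5)
    moreover have "\<dots> * P M (q ^ 25) = P (5 * M) (q ^ 5) * P M (q ^ 5) ^ 5"
    proof (induction M)
      case (Suc M)
      define f where "f = (\<lambda>k. if 5 dvd k then (1 - q ^ k) ^ 5 else 1 - (q ^ k) ^ 5)"
      define g where "g = (\<lambda>k. 1 - (q ^ 5) ^ k)"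
      define n where "n = 5 * M"
      have n: "5 * Suc M = n + 5"
        by (simp add: n_def)
      have f: "f (n + 1) = g (n + 1)" "f (n + 2) = g (n + 2)" "f (n + 3) = g (n + 3)" "f (n + 4) = g (n + 4)"
        "f (n + 5) = g (Suc M) ^ 5"
      proof -
        have "\<not> 5 dvd n + 1" "\<not> 5 dvd n + 2" "\<not> 5 dvd n + 3" "\<not> 5 dvd n + 4"
          unfolding n_def by presburger+
        thus "f (n + 1) = g (n + 1)" "f (n + 2) = g (n + 2)" "f (n + 3) = g (n + 3)" "f (n + 4) = g (n + 4)"
          unfolding f_def g_def power_mult[symmetric] by (simp_all only: mult.commute if_False)
        have "n + 5 = 5 * Suc M"
          by (simp add: n_def)
        thus "f (n + 5) = g (Suc M) ^ 5"
          unfolding f_def g_def power_mult[symmetric] by (simp add: add.commute)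
      qed
      have g: "1 - (q ^ 25) ^ Suc M = g (n + 5)"
        by (simp add: g_def n_def algebra_simps flip: power_mult power_add power_Suc)
      have PM: "P (Suc M) x = P M x * (1 - x ^ Suc M)" for x
        by (simp add: P_def mult_ac)
      have P5: "P (5 * Suc M) (q ^ 5) = P n (q ^ 5) * (g (n+1) * g (n+2) * g (n+3) * g (n+4) * g (n+5))"
        unfolding P_def n by (rule prod_atMost_add5[of g n, unfolded g_def[abs_def]] | simp only: g_def prod_atMost_add5)+
      have IH: "(\<Prod>k=1..n. f k) * P M (q ^ 25) = P n (q ^ 5) * P M (q ^ 5) ^ 5"
        using Suc.IH by (simp add: f_def n_def)
      have "(\<Prod>k=1..5 * Suc M. f k) * P (Suc M) (q ^ 25) =
          ((\<Prod>k=1..n. f k) * P M (q ^ 25)) * (f (n+1) * f (n+2) * f (n+3) * f (n+4) * f (n+5)) * g (n + 5)"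
        unfolding n PM prod_atMost_add5 g by (simp only: mult_ac)
      also have "\<dots> = P (5 * Suc M) (q ^ 5) * P (Suc M) (q ^ 5) ^ 5"
        unfolding P5 PM IH f power_mult_distrib by (simp add: g_def mult_ac)
      finally show ?case
        by (simp only: f_def)
    qed (simp add: P_def)
    ultimately show ?thesis
      by simp
  qed
  have "(\<lambda>M. (\<Prod>i<5. P (5 * M) (zeta5 ^ i * q)) * P M (q ^ 25)) \<longlonglongrightarrow> (\<Prod>i<5. euler (zeta5 ^ i * q)) * euler (q ^ 25)"
    by (intro tendsto_mult tendsto_prod P pw) (simp_all add: norm_zeta5_mult assms)
  moreover have "(\<lambda>M. P (5 * M) (q ^ 5) * P M (q ^ 5) ^ 5) \<longlonglongrightarrow> euler (q ^ 5) * euler (q ^ 5) ^ 5"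
    by (intro tendsto_intros P pw) auto
  ultimately have "(\<Prod>i<5. euler (zeta5 ^ i * q)) * euler (q ^ 25) = euler (q ^ 5) * euler (q ^ 5) ^ 5"
    unfolding fin by (rule LIMSEQ_unique)
  thus ?thesis
    by (simp add: eval_nat_numeral)
qed

lemma sum_L2_zeta5:
  assumes "norm q < 1"
  shows "(\<Sum>i<5. L2 (zeta5 ^ i * q)) = 25 * L2 (q ^ 5)"
proof -
  define t where "t = (\<lambda>q n. of_nat n / (1 - q ^ (5 * n)) * (\<Sum>j=1..4. chi35 j * q ^ (j * n)))"
  have "norm (q ^ 5) < 1"
    using assms by (simp add: norm_power power_less_one_iff)
  hence "(\<lambda>m. 25 * t (q ^ 5) m) sums (25 * L2 (q ^ 5))"
    unfolding t_def by (intro sums_mult L2_sums)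
  have tsum: "(\<Sum>i<5. t (zeta5 ^ i * q) n) = (if 5 dvd n then 5 * t q n else 0)" for n
  proof -
    have "(\<Sum>i<5. t (zeta5 ^ i * q) n) = of_nat n / (1 - q ^ (5 * n)) *
        (\<Sum>j=1..4. chi35 j * q ^ (j * n) * (\<Sum>i<5. (zeta5 ^ (j * n)) ^ i))"
    proof -
      have "(zeta5 ^ i * q) ^ (5 * n) = q ^ (5 * n)" for i
      proof -
        have "(zeta5 ^ i) ^ (5 * n) = 1"
          using zeta5_power_eq_1_iff[of "i * (5 * n)"] by (simp flip: power_mult)
        thus ?thesis
          by (simp add: power_mult_distrib)
      qed
      hence "(\<Sum>i<5. t (zeta5 ^ i * q) n) = of_nat n / (1 - q ^ (5 * n)) *
          (\<Sum>i<5. \<Sum>j=1..4. chi35 j * (zeta5 ^ i * q) ^ (j * n))"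
        by (simp add: t_def sum_distrib_left)
      also have "(\<Sum>i<5. \<Sum>j=1..4. chi35 j * (zeta5 ^ i * q) ^ (j * n)) =
          (\<Sum>j=1..4. chi35 j * q ^ (j * n) * (\<Sum>i<5. (zeta5 ^ (j * n)) ^ i))"
        unfolding sum_distrib_left
        by (subst sum.swap) (simp add: power_mult_distrib mult_ac flip: power_mult)
      finally show ?thesis .
    qed
    also have "(\<Sum>j=1..4. chi35 j * q ^ (j * n) * (\<Sum>i<5. (zeta5 ^ (j * n)) ^ i)) =
        (\<Sum>j=1..4. chi35 j * q ^ (j * n) * (if 5 dvd n then 5 else 0))"
    proof (intro sum.cong refl arg_cong2[of _ _ _ _ "(*)"])
      fix j :: nat assume j: "j \<in> {1..4}"
      have "j = 1 \<or> j = 2 \<or> j = 3 \<or> j = 4"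
        using j by auto
      hence "5 dvd j * n \<longleftrightarrow> 5 dvd n"
        by (elim disjE) (simp only:, presburger)+
      hence iff: "zeta5 ^ (j * n) = 1 \<longleftrightarrow> 5 dvd n"
        by (simp only: zeta5_power_eq_1_iff)
      have "(zeta5 ^ (j * n)) ^ 5 = 1"
        by (simp add: zeta5_power_eq_1_iff flip: power_mult)
      thus "(\<Sum>i<5. (zeta5 ^ (j * n)) ^ i) = (if 5 dvd n then 5 else 0)"
        using iff root_unity5_sum[of "zeta5 ^ (j * n)"] by (auto simp: lessThan_5)
    qed
    finally show ?thesis
      by (auto simp: t_def sum_distrib_right[symmetric])
  qed
  have "(\<lambda>n. \<Sum>i<5. t (zeta5 ^ i * q) n) sums (\<Sum>i<5. L2 (zeta5 ^ i * q))"
    unfolding t_def by (intro sums_sum L2_sums) (simp add: norm_zeta5_mult assms)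
  hence "(\<lambda>m. \<Sum>i<5. t (zeta5 ^ i * q) (5 * m)) sums (\<Sum>i<5. L2 (zeta5 ^ i * q))"
    by (subst sums_mono_reindex) (auto simp: strict_mono_def tsum image_iff dvd_def)
  also have "(\<lambda>m. \<Sum>i<5. t (zeta5 ^ i * q) (5 * m)) = (\<lambda>m. 25 * t (q ^ 5) m)"
    unfolding tsum by (rule ext) (simp add: t_def mult_ac flip: power_mult)
  finally show ?thesis
    using \<open>(\<lambda>m. 25 * t (q ^ 5) m) sums (25 * L2 (q ^ 5))\<close> sums_unique2 by blast
qed

theorem E2_eq_euler:
  assumes q: "norm q < 1" "q \<noteq> 0"
  shows "E2 q = euler q ^ 5 / euler (q ^ 5)"
proof -
  define w where "w = zeta5"
  define s where "s = w - w\<^sup>2 - w ^ 3 + w ^ 4"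
  have w5: "w ^ 5 = 1" and w1: "w \<noteq> 1"
    using zeta5_power_eq_1_iff[of 5] zeta5_power_eq_1_iff[of 1] by (auto simp: w_def)
  have w4: "w ^ 4 = - 1 - w - w\<^sup>2 - w ^ 3"
    using root_unity5_sum[OF w5 w1] .
  have [simp]: "norm w = 1" "w \<noteq> 0"
    using w5 by (auto simp: w_def)
  have w2: "w\<^sup>2 \<noteq> 1"
    using zeta5_power_eq_1_iff[of 2] by (auto simp: w_def)
  have s2: "s\<^sup>2 = 5"
    using w4 w5 unfolding s_def by algebra
  hence "s \<noteq> 0"
    by auto
  have inv: "1 / w = w ^ 4" "1 / w\<^sup>2 = w ^ 3"
    using w5 by (simp_all add: field_simps flip: power_Suc power_add)
  have inv': "q / w = w ^ 4 * q" "q / w\<^sup>2 = w ^ 3 * q"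
    using inv by (simp_all add: field_simps)
  have ann: "w \<in> annulus q" "w\<^sup>2 \<in> annulus q"
    using q by (auto simp: annulus_def norm_mult norm_power)
  have diff: "eis2 q w - eis2 q (w\<^sup>2) = - s / 5 * E2 q"
  proof -
    define c where "c = (\<lambda>n. of_nat n / (1 - q ^ n) * q ^ n)"
    have l: "(\<lambda>n. c n * (w ^ j) ^ n) sums lambert2 q (w ^ j * q)" for j
      using summable_sums[OF summable_lambert2[of q "w ^ j * q"]] q
      by (simp add: lambert2_def c_def power_mult_distrib norm_mult norm_power mult_ac)
    have chi: "(w ^ 1) ^ n + (w ^ 4) ^ n - (w ^ 2) ^ n - (w ^ 3) ^ n = s * chi35 n" for n
    proof -
      have red: "(w ^ j) ^ n = w ^ (j * (n mod 5))" for j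
      proof -
        have "(w ^ j) ^ n = w ^ ((j * n) mod 5)"
          by (simp add: w_def zeta5_power_mod power_mult)
        also have "\<dots> = w ^ ((j * (n mod 5)) mod 5)"
          by (simp add: mod_mult_right_eq)
        finally show ?thesis
          by (simp add: w_def zeta5_power_mod)
      qed
      have p: "w ^ 6 = w" "w ^ 8 = w ^ 3" "w ^ 9 = w ^ 4" "w ^ 12 = w ^ 2" "w ^ 16 = w"
        using zeta5_power_mod[of 6] zeta5_power_mod[of 8] zeta5_power_mod[of 9] zeta5_power_mod[of 12]
          zeta5_power_mod[of 16] by (simp_all add: w_def)
      have "n mod 5 < 5" by simp
      hence "n mod 5 \<in> {0,1,2,3,4}" by auto
      thus ?thesis
        unfolding red chi35_def by (auto simp: p s_def)
    qed
    have "(\<lambda>n. c n * (w ^ 1) ^ n + c n * (w ^ 4) ^ n - c n * (w ^ 2) ^ n - c n * (w ^ 3) ^ n) sums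
        (lambert2 q (w ^ 1 * q) + lambert2 q (w ^ 4 * q) - lambert2 q (w ^ 2 * q) - lambert2 q (w ^ 3 * q))"
      by (intro sums_add sums_diff l)
    also have "(\<lambda>n. c n * (w ^ 1) ^ n + c n * (w ^ 4) ^ n - c n * (w ^ 2) ^ n - c n * (w ^ 3) ^ n) =
        (\<lambda>n. s * (c n * chi35 n))"
    proof
      fix n
      have "c n * (w ^ 1) ^ n + c n * (w ^ 4) ^ n - c n * (w ^ 2) ^ n - c n * (w ^ 3) ^ n =
          c n * ((w ^ 1) ^ n + (w ^ 4) ^ n - (w ^ 2) ^ n - (w ^ 3) ^ n)"
        by (simp only: algebra_simps)
      thus "c n * (w ^ 1) ^ n + c n * (w ^ 4) ^ n - c n * (w ^ 2) ^ n - c n * (w ^ 3) ^ n = s * (c n * chi35 n)"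
        unfolding chi by simp
    qed
    finally have *: "(\<lambda>n. s * (c n * chi35 n)) sums
        (lambert2 q (w * q) + lambert2 q (w ^ 4 * q) - lambert2 q (w\<^sup>2 * q) - lambert2 q (w ^ 3 * q))"
      by simp
    have "summable (\<lambda>n. c n * chi35 n)"
      using summable_mult_D[OF sums_summable[OF *]] \<open>s \<noteq> 0\<close> by simp
    hence "(\<Sum>n. c (Suc n) * chi35 (Suc n)) = (\<Sum>n. c n * chi35 n) - c 0 * chi35 0"
      by (rule suminf_split_head)
    also have "c 0 = 0"
      by (simp add: c_def)
    finally have "E2 q = 1 - 5 * (\<Sum>n. c n * chi35 n)"
      by (simp add: E2_def c_def mult_ac)
    moreover have "s * (\<Sum>n. c n * chi35 n) =
        lambert2 q (w * q) + lambert2 q (w ^ 4 * q) - lambert2 q (w\<^sup>2 * q) - lambert2 q (w ^ 3 * q)"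
      using * \<open>summable (\<lambda>n. c n * chi35 n)\<close> by (simp add: sums_iff suminf_mult)
    moreover have "w / (1 - w)\<^sup>2 - w\<^sup>2 / (1 - w\<^sup>2)\<^sup>2 = - s / 5"
    proof -
      have "(w * (1 - w\<^sup>2)\<^sup>2 - w\<^sup>2 * (1 - w)\<^sup>2) * 5 = - s * ((1 - w)\<^sup>2 * (1 - w\<^sup>2)\<^sup>2)"
        using w4 w5 unfolding s_def by algebra
      thus ?thesis
        using w1 w2 by (simp add: divide_simps) 
    qed
    moreover have "eis2 q w - eis2 q (w\<^sup>2) = (w / (1 - w)\<^sup>2 - w\<^sup>2 / (1 - w\<^sup>2)\<^sup>2) +
        (lambert2 q (w * q) + lambert2 q (w ^ 4 * q) - lambert2 q (w\<^sup>2 * q) - lambert2 q (w ^ 3 * q))"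
      by (simp add: eis2_def inv')
    ultimately have "eis2 q w - eis2 q (w\<^sup>2) = - s / 5 + s * (\<Sum>n. c n * chi35 n)"
      and E2: "E2 q = 1 - 5 * (\<Sum>n. c n * chi35 n)"
      by simp_all
    thus ?thesis
      unfolding E2 by (simp add: algebra_simps)
  qed
  have th: "theta q (w * w\<^sup>2) = - theta q (w\<^sup>2) * w ^ 3"
  proof -
    have "theta q (w ^ 3) = - theta q (w\<^sup>2) * (1 / w\<^sup>2)"
      using theta_inverse[OF q(1), of "w\<^sup>2"] by (simp flip: inv)
    thus ?thesis
      unfolding inv by (simp flip: power_Suc)
  qed
  have prod: "theta' q w * theta' q (w\<^sup>2) * euler q = euler (q ^ 5)"
  proof -
    have q5: "norm (q ^ 5) < 1"
      using q by (simp add: norm_power power_less_one_iff)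
    have "(\<lambda>n. (\<Prod>k<n. 1 - (w * q) * q ^ k) * (\<Prod>k<n. 1 - (w ^ 4 * q) * q ^ k) * ((\<Prod>k<n. 1 - (w\<^sup>2 * q) * q ^ k) *
        (\<Prod>k<n. 1 - (w ^ 3 * q) * q ^ k)) * (\<Prod>k<n. 1 - q * q ^ k)) \<longlonglongrightarrow> theta' q w * theta' q (w\<^sup>2) * euler q"
      unfolding theta'_def inv' euler_def by (intro tendsto_mult qpoch_LIMSEQ q)
    also have "(\<lambda>n. (\<Prod>k<n. 1 - (w * q) * q ^ k) * (\<Prod>k<n. 1 - (w ^ 4 * q) * q ^ k) * ((\<Prod>k<n. 1 - (w\<^sup>2 * q) * q ^ k) *
        (\<Prod>k<n. 1 - (w ^ 3 * q) * q ^ k)) * (\<Prod>k<n. 1 - q * q ^ k)) = (\<lambda>n. \<Prod>k<n. 1 - q ^ 5 * (q ^ 5) ^ k)"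
    proof (rule ext, unfold prod.distrib [symmetric], rule prod.cong)
      fix n k :: nat
      have "(\<Prod>i<5. 1 - w ^ i * q ^ Suc k) = 1 - (q ^ Suc k) ^ 5"
        by (rule prod_root_unity5[OF w5 w1])
      thus "(1 - w * q * q ^ k) * (1 - w ^ 4 * q * q ^ k) * ((1 - w\<^sup>2 * q * q ^ k) * (1 - w ^ 3 * q * q ^ k)) *
          (1 - q * q ^ k) = 1 - q ^ 5 * (q ^ 5) ^ k"
        by (simp add: lessThan_5 power_mult_distrib mult_ac flip: power_mult)
    qed auto
    finally show ?thesis
      using qpoch_LIMSEQ[OF q5, of "q ^ 5"] LIMSEQ_unique unfolding euler_def by blast
  qed
  have nz: "theta' q w \<noteq> 0" "theta' q (w\<^sup>2) \<noteq> 0" "euler q \<noteq> 0"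
    using theta'_nonzero[OF q(1)] ann euler_nonzero[OF q(1)] by auto
  have "- s / 5 * E2 q = w * euler q ^ 4 * theta q (w * w\<^sup>2) * theta q (w\<^sup>2 / w) / ((theta q w)\<^sup>2 * (theta q (w\<^sup>2))\<^sup>2)"
    unfolding diff[symmetric] euler_def by (rule eis2_diff[OF q ann(1) w1 ann(2) w2])
  also have "w\<^sup>2 / w = w"
    by (simp add: power2_eq_square)
  also have "w * euler q ^ 4 * theta q (w * w\<^sup>2) * theta q w / ((theta q w)\<^sup>2 * (theta q (w\<^sup>2))\<^sup>2) =
      - (w ^ 4) * euler q ^ 4 / (theta q w * theta q (w\<^sup>2))"
    unfolding th using theta_nonzero[OF q(1) ann(1) w1] theta_nonzero[OF q(1) ann(2) w2]
    by (simp add: divide_simps) (simp add: power2_eq_square eval_nat_numeral)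
  also have "theta q w * theta q (w\<^sup>2) = (w ^ 4 * s) * (euler (q ^ 5) / euler q)"
  proof -
    have "(1 - w) * (1 - w\<^sup>2) = w ^ 4 * s"
      using w4 w5 unfolding s_def by algebra
    moreover have "theta' q w * theta' q (w\<^sup>2) = euler (q ^ 5) / euler q"
      using prod nz by (simp add: field_simps)
    moreover have "theta q w * theta q (w\<^sup>2) = ((1 - w) * (1 - w\<^sup>2)) * (theta' q w * theta' q (w\<^sup>2))"
      by (simp add: theta_altdef q mult_ac)
    ultimately show ?thesis
      by simp
  qed
  also have "- (w ^ 4) * X ^ 4 / (w ^ 4 * s * (Y / X)) = - (1 / s) * (X ^ 5 / Y)" for X Y
    by (simp add: field_simps eval_nat_numeral)
  also have "1 / s = s / 5"
    using \<open>s \<noteq> 0\<close> s2 by (simp add: field_simps power2_eq_square)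
  finally have "s * E2 q = s * (euler q ^ 5 / euler (q ^ 5))"
    by simp
  thus ?thesis
    using \<open>s \<noteq> 0\<close> by (simp only: mult_cancel_left) simp
qed

subsection \<open>Euler's function as a formal power series\<close>

definition euler_poly :: "nat \<Rightarrow> 'a :: comm_ring_1 fps" where
  "euler_poly N = (\<Prod>k=1..N. 1 - fps_X ^ k)"

definition fps_euler :: "'a :: comm_ring_1 fps" where
  "fps_euler = Abs_fps (\<lambda>n. fps_nth (euler_poly n) n)"

lemma euler_poly_Suc: "euler_poly (Suc N) = euler_poly N * (1 - fps_X ^ Suc N)"
  by (simp add: euler_poly_def mult.commute)

lemma fps_nth_euler_poly: "n \<le> N \<Longrightarrow> fps_nth (euler_poly N) n = fps_nth fps_euler n"
proof (induction N rule: dec_induct)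
  case (step N)
  thus ?case
    by (simp add: euler_poly_Suc ring_distribs fps_X_power_mult_right_nth del: power_Suc)
qed (simp add: fps_euler_def)

lemma fps_nth_euler_0 [simp]: "fps_nth fps_euler 0 = 1"
  by (simp add: fps_euler_def euler_poly_def)

lemma fps_euler_nonzero [simp]: "fps_euler \<noteq> (0 :: 'a :: comm_ring_1 fps)"
  using fps_nth_euler_0[where ?'a = 'a] by (metis fps_zero_nth zero_neq_one)

lemma euler_has_fps_expansion [fps_expansion_intros]: "euler has_fps_expansion fps_euler"
proof -
  define f where "f = (\<lambda>N (q::complex). \<Prod>k<N. 1 - q * q ^ k)"
  have lim: "uniform_limit (cball 0 (1/2)) f euler sequentially"
    unfolding f_def euler_def[abs_def] by (rule uniform_limit_qpoch) (auto intro!: continuous_intros)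
  have nth: "(deriv ^^ n) (f N) 0 = fact n * fps_nth (euler_poly N) n" for n N
  proof -
    have "(\<lambda>q. \<Prod>k=1..N. 1 - q ^ k) has_fps_expansion euler_poly N"
      unfolding euler_poly_def by (intro fps_expansion_intros)
    also have "(\<lambda>q. \<Prod>k=1..N. 1 - q ^ k) = f N"
      unfolding f_def by (induction N) (simp_all add: fun_eq_iff)
    finally show ?thesis
      using fps_nth_fps_expansion by (metis fact_nonzero nonzero_mult_div_cancel_left times_divide_eq_right)
  qed
  have "fps_nth (fps_expansion euler 0) n = fps_nth fps_euler n" for n
  proof -
    have "(\<lambda>N. (deriv ^^ n) (f N) 0) \<longlonglongrightarrow> (deriv ^^ n) euler 0"
      by (rule higher_deriv_complex_uniform_limit[where A = "ball 0 (1/2)"])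
         (auto intro!: uniform_limit_on_subset[OF lim[unfolded f_def]] always_eventually holomorphic_intros simp: f_def)
    moreover have "(\<lambda>N. (deriv ^^ n) (f N) 0) \<longlonglongrightarrow> fact n * fps_nth fps_euler n"
      by (rule tendsto_eventually) (use eventually_ge_at_top[of n] in \<open>eventually_elim, simp add: nth fps_nth_euler_poly\<close>)
    ultimately show ?thesis
      using LIMSEQ_unique by (force simp: fps_expansion_def)
  qed
  hence "fps_expansion euler 0 = fps_euler"
    by (simp add: fps_eq_iff)
  moreover have "euler has_fps_expansion fps_expansion euler 0"
    by (rule has_fps_expansion_fps_expansion[of "ball 0 1"]) (auto intro!: holomorphic_intros)
  ultimately show ?thesis
    by simp
qed

subsection \<open>The generating function of partitions\<close>

definition partitions_upto :: "nat \<Rightarrow> nat \<Rightarrow> nat multiset set" where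
  "partitions_upto N n = {M. set_mset M \<subseteq> {1..N} \<and> sum_mset M = n}"

lemma partitions_upto_0: "partitions_upto 0 n = (if n = 0 then {{#}} else {})"
  by (auto simp: partitions_upto_def)

lemma partitions_upto_Suc:
  "partitions_upto (Suc N) n =
     partitions_upto N n \<union> (if n < Suc N then {} else add_mset (Suc N) ` partitions_upto (Suc N) (n - Suc N))"
  (is "?L = ?R")
proof
  show "?L \<subseteq> ?R"
  proof
    fix M assume M: "M \<in> ?L"
    show "M \<in> ?R"
    proof (cases "Suc N \<in># M")
      case True
      then obtain M' where M': "M = add_mset (Suc N) M'"
        by (metis insert_DiffM)
      hence "M' \<in> partitions_upto (Suc N) (n - Suc N)" "n \<ge> Suc N"
        using M by (auto simp: partitions_upto_def)
      thus ?thesis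
        using M' by auto
    next
      case False
      have "set_mset M \<subseteq> {1..N}"
      proof
        fix x assume "x \<in># M"
        hence "x \<in> {1..Suc N}" "x \<noteq> Suc N"
          using M False by (auto simp: partitions_upto_def)
        thus "x \<in> {1..N}"
          by auto
      qed
      hence "M \<in> partitions_upto N n"
        using M by (simp add: partitions_upto_def)
      thus ?thesis
        by auto
    qed
  qed
next
  have "partitions_upto N n \<subseteq> partitions_upto (Suc N) n"
    by (auto simp: partitions_upto_def)
  moreover have "add_mset (Suc N) M \<in> partitions_upto (Suc N) n"
    if "M \<in> partitions_upto (Suc N) (n - Suc N)" "\<not> n < Suc N" for M
    using that by (auto simp: partitions_upto_def)
  ultimately show "?R \<subseteq> ?L"
    by auto
qed

lemma finite_partitions_upto: "finite (partitions_upto N n)"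
proof (induction N arbitrary: n)
  case (Suc N)
  show ?case
  proof (induction n rule: less_induct)
    case (less n)
    show ?case
      using Suc.IH[of n] less.IH[of "n - Suc N"] by (subst partitions_upto_Suc) auto
  qed
qed (simp add: partitions_upto_0)

lemma card_partitions_upto_Suc:
  "card (partitions_upto (Suc N) n) =
     card (partitions_upto N n) + (if n < Suc N then 0 else card (partitions_upto (Suc N) (n - Suc N)))"
proof (cases "n < Suc N")
  case True
  have "partitions_upto (Suc N) n = partitions_upto N n"
    unfolding partitions_upto_Suc[of N n] by (simp only: True if_True Un_empty_right)
  thus ?thesis
    by (simp only: True if_True add_0_right)
next
  case False
  define A where "A = partitions_upto (Suc N) (n - Suc N)"
  have "partitions_upto (Suc N) n = partitions_upto N n \<union> add_mset (Suc N) ` A"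
    unfolding partitions_upto_Suc[of N n] by (simp only: False if_False A_def)
  moreover have "M \<notin> partitions_upto N n" if "M \<in> add_mset (Suc N) ` A" for M
  proof -
    have "Suc N \<in># M"
      using that by force
    thus ?thesis
      by (force simp: partitions_upto_def)
  qed
  hence "card (partitions_upto N n \<union> add_mset (Suc N) ` A) = card (partitions_upto N n) + card (add_mset (Suc N) ` A)"
    unfolding A_def by (intro card_Un_disjoint finite_imageI finite_partitions_upto) blast
  moreover have "card (add_mset (Suc N) ` A) = card A"
    by (intro card_image inj_onI) simp
  ultimately show ?thesis
    by (simp only: False if_False A_def)
qed

lemma partitions_upto_eq: "n \<le> N \<Longrightarrow> num_partitions (int n) = card (partitions_upto N n)"
proof -
  assume n: "n \<le> N"
  have "{M. 0 \<notin># M \<and> sum_mset M = n} = partitions_upto N n"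
  proof (intro equalityI subsetI)
    fix M assume M: "M \<in> {M. 0 \<notin># M \<and> sum_mset M = n}"
    have "x \<in> {1..N}" if "x \<in># M" for x
    proof -
      have "x \<le> sum_mset M"
        using that by (metis insert_DiffM le_add1 sum_mset.add_mset)
      moreover have "x \<noteq> 0"
        using M that by (metis (mono_tags, lifting) mem_Collect_eq)
      ultimately show ?thesis
        using M n by auto
    qed
    thus "M \<in> partitions_upto N n"
      using M by (auto simp: partitions_upto_def)
  qed (auto simp: partitions_upto_def)
  thus ?thesis
    by (simp only: num_partitions_def of_nat_eq_iff)
qed

lemma num_partitions_neg [simp]:
  assumes "n < 0"
  shows "num_partitions n = 0"
proof -
  have "int (sum_mset M) \<noteq> n" for M :: "nat multiset"
    using assms of_nat_0_le_iff[of "sum_mset M", where ?'a = int] by linarith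
  thus ?thesis
    by (simp add: num_partitions_def del: of_nat_sum_mset)
qed

definition fps_partitions :: "'a :: comm_ring_1 fps" where
  "fps_partitions = Abs_fps (\<lambda>n. of_nat (num_partitions (int n)))"

lemma fps_partitions_mult_euler: "fps_partitions * fps_euler = (1 :: 'a :: comm_ring_1 fps)"
proof (rule fps_ext)
  fix n
  define F :: "nat \<Rightarrow> 'a fps" where "F = (\<lambda>N. Abs_fps (\<lambda>n. of_nat (card (partitions_upto N n))))"
  have F0: "F 0 = 1"
    by (rule fps_ext) (simp add: F_def partitions_upto_0)
  have FSuc: "F (Suc N) * (1 - fps_X ^ Suc N) = F N" for N
  proof (rule fps_ext)
    fix n
    show "fps_nth (F (Suc N) * (1 - fps_X ^ Suc N)) n = fps_nth (F N) n"
      using card_partitions_upto_Suc[of N n]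
      by (simp add: ring_distribs fps_X_power_mult_right_nth F_def del: power_Suc)
  qed
  have FE: "F N * euler_poly N = 1" for N
  proof (induction N)
    case (Suc N)
    have "F (Suc N) * euler_poly (Suc N) = (F (Suc N) * (1 - fps_X ^ Suc N)) * euler_poly N"
      by (simp only: euler_poly_Suc mult_ac)
    thus ?case
      by (simp only: FSuc Suc)
  qed (simp add: F0 euler_poly_def)
  have "fps_nth (fps_partitions * fps_euler) n = fps_nth (F n * euler_poly n) n"
    unfolding fps_mult_nth
    by (intro sum.cong refl arg_cong2[of _ _ _ _ "(*)"])
       (auto simp: fps_partitions_def F_def partitions_upto_eq[of _ n] fps_nth_euler_poly)
  thus "fps_nth (fps_partitions * fps_euler) n = fps_nth (1 :: 'a fps) n"
    by (simp only: FE)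
qed

subsection \<open>The pentagonal number theorem\<close>

text \<open>Shanks's finite form of the pentagonal number theorem.\<close>
lemma shanks_identity:
  fixes q :: "'a :: comm_ring_1"
  shows "(\<Sum>s\<le>n. (-1) ^ s * (\<Prod>k\<in>{s<..n}. 1 - q ^ k) * q ^ (s * n + s * (s + 1) div 2)) =
         1 + (\<Sum>k=1..n. (-1) ^ k * (q ^ (k * (3 * k - 1) div 2) + q ^ (k * (3 * k + 1) div 2)))"
proof (induction n)
  case (Suc m)
  define R where "R = (\<lambda>m s. \<Prod>k\<in>{s<..m}. 1 - q ^ k)"
  define T where "T = (\<lambda>s. (-1) ^ s * R m s * q ^ ((s + 1) * (m + 1) + s * (s + 1) div 2))"
  define U where "U = (\<lambda>s. (-1) ^ s * R m s * q ^ (s * m + s * (s + 1) div 2))"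
  have RSuc: "R (Suc m) s = R m s * (1 - q ^ Suc m)" if "s \<le> m" for s
  proof -
    have "{s<..Suc m} = insert (Suc m) {s<..m}"
      using that by auto
    thus ?thesis
      by (simp add: R_def mult.commute)
  qed
  have RSuc': "R m s = (1 - q ^ Suc s) * R m (Suc s)" if "s < m" for s
  proof -
    have "{s<..m} = insert (Suc s) {Suc s<..m}"
      using that by auto
    thus ?thesis
      by (simp add: R_def)
  qed
  have tri: "Suc s * (Suc s + 1) div 2 = s * (s + 1) div 2 + Suc s" for s :: nat
    by simp
  have tel: "(\<Sum>s\<le>j. U s * (q ^ s - 1) - T s) = - T j" if "j \<le> m" for j
    using that
  proof (induction j)
    case (Suc j)
    have "U (Suc j) * (q ^ Suc j - 1) = T j"
      unfolding U_def T_def tri using Suc.prems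
      by (simp add: RSuc'[of j] algebra_simps power_add)
    thus ?case
      using Suc by simp
  qed (simp add: U_def)
  have "(\<Sum>s\<le>Suc m. (-1) ^ s * R (Suc m) s * q ^ (s * Suc m + s * (s + 1) div 2)) =
      (\<Sum>s\<le>m. (-1) ^ s * R (Suc m) s * q ^ (s * Suc m + s * (s + 1) div 2)) +
      (-1) ^ Suc m * q ^ (Suc m * Suc m + Suc m * (Suc m + 1) div 2)"
    by (simp add: R_def)
  also have "(\<Sum>s\<le>m. (-1) ^ s * R (Suc m) s * q ^ (s * Suc m + s * (s + 1) div 2)) =
      (\<Sum>s\<le>m. U s + (U s * (q ^ s - 1) - T s))"
    by (intro sum.cong refl) (simp add: RSuc U_def T_def algebra_simps power_add)
  also have "\<dots> = (\<Sum>s\<le>m. U s) - T m"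
    using tel[of m] by (simp add: sum.distrib)
  also have "T m = (-1) ^ m * q ^ (Suc m * (3 * Suc m - 1) div 2)"
  proof -
    have "(m + 1) * (m + 1) + m * (m + 1) div 2 = Suc m * (3 * Suc m - 1) div 2"
    proof -
      have "Suc m * (3 * Suc m - 1) = 2 * ((m + 1) * (m + 1)) + m * (m + 1)"
        by (simp add: algebra_simps)
      thus ?thesis
        by simp
    qed
    thus ?thesis
      by (simp add: T_def R_def)
  qed
  also have "Suc m * Suc m + Suc m * (Suc m + 1) div 2 = Suc m * (3 * Suc m + 1) div 2"
  proof -
    have "Suc m * (3 * Suc m + 1) = 2 * (Suc m * Suc m) + Suc m * (Suc m + 1)"
      by (simp add: algebra_simps)
    thus ?thesis
      by simp
  qed
  finally show ?case
    using Suc.IH by (simp add: R_def U_def algebra_simps)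
qed simp

lemma pentagonal_coeff_sum:
  "fps_nth (fps_euler :: 'a :: comm_ring_1 fps) i =
     (if i = 0 then 1 else 0) + (\<Sum>k=1..i. (-1) ^ k * ((if i = k * (3 * k - 1) div 2 then 1 else 0) +
        (if i = k * (3 * k + 1) div 2 then 1 else 0)))"
proof -
  define t :: "nat \<Rightarrow> 'a fps"
    where "t = (\<lambda>s. (-1) ^ s * (\<Prod>k\<in>{s<..i}. 1 - fps_X ^ k) * fps_X ^ (s * i + s * (s + 1) div 2))"
  have neg1: "(-1) ^ k = fps_const ((-1) ^ k :: 'a)" for k
    by (simp flip: fps_const_power fps_const_neg)
  have "fps_nth (t s) i = 0" if "s \<in> {..i} - {0}" for s
  proof -
    have "i < s * i + s * (s + 1) div 2"
    proof -
      have "1 * i \<le> s * i"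
        using that by (intro mult_right_mono) auto
      moreover have "s * (s + 1) div 2 \<ge> 1"
        using that by (cases s) auto
      ultimately show ?thesis
        by linarith
    qed
    thus ?thesis
      unfolding t_def by (simp add: fps_X_power_mult_right_nth)
  qed
  hence "fps_nth (\<Sum>s\<le>i. t s) i = fps_nth (t 0) i"
    by (simp add: fps_sum_nth sum.remove[of "{..i}" 0])
  also have "t 0 = euler_poly i"
    by (auto simp: t_def euler_poly_def intro!: prod.cong)
  also have "fps_nth (euler_poly i) i = (fps_nth fps_euler i :: 'a)"
    by (simp add: fps_nth_euler_poly)
  finally have "fps_nth fps_euler i = fps_nth (\<Sum>s\<le>i. t s) i" ..
  also have "(\<Sum>s\<le>i. t s) =
      1 + (\<Sum>k=1..i. fps_const ((-1) ^ k) * (fps_X ^ (k * (3 * k - 1) div 2) + fps_X ^ (k * (3 * k + 1) div 2)))"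
    unfolding t_def using shanks_identity[of "fps_X :: 'a fps" i] by (simp only: neg1)
  finally show ?thesis
    by (simp add: fps_sum_nth eq_commute[of _ i] cong: if_cong)
qed

lemma pentagonal_inj:
  fixes k l :: int
  assumes "k * (3 * k + 1) = l * (3 * l + 1)"
  shows "k = l"
proof -
  have "(k - l) * (3 * (k + l) + 1) = 0"
    using assms by (simp add: algebra_simps)
  moreover have "3 * (k + l) + 1 \<noteq> 0"
    by presburger
  ultimately show ?thesis
    by simp
qed

lemma pentagonal_eq_iff:
  fixes i k :: nat
  shows "i = k * (3 * k + 1) div 2 \<longleftrightarrow> 2 * int i = int k * (3 * int k + 1)"
    and "k > 0 \<Longrightarrow> i = k * (3 * k - 1) div 2 \<longleftrightarrow> 2 * int i = - int k * (3 * (- int k) + 1)"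
proof -
  have *: "i = n div 2 \<longleftrightarrow> 2 * int i = int n" if "even n" for n
    using that by auto
  show "i = k * (3 * k + 1) div 2 \<longleftrightarrow> 2 * int i = int k * (3 * int k + 1)"
    by (subst *) (auto simp: algebra_simps)
  assume "k > 0"
  thus "i = k * (3 * k - 1) div 2 \<longleftrightarrow> 2 * int i = - int k * (3 * (- int k) + 1)"
    by (subst *) (auto simp: of_nat_diff algebra_simps)
qed

theorem pentagonal_number_theorem:
  fixes i :: nat
  shows "2 * int i = k * (3 * k + 1) \<Longrightarrow> fps_nth (fps_euler :: 'a :: comm_ring_1 fps) i = (-1) ^ nat \<bar>k\<bar>"
    and "(\<And>k. 2 * int i \<noteq> k * (3 * k + 1)) \<Longrightarrow> fps_nth (fps_euler :: 'a fps) i = 0"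
proof -
  define c :: "int \<Rightarrow> 'a" where "c = (\<lambda>k. if 2 * int i = k * (3 * k + 1) then (-1) ^ nat \<bar>k\<bar> else 0)"
  have "fps_nth (fps_euler :: 'a fps) i = c 0 + (\<Sum>k=1..i. c (- int k) + c (int k))"
    unfolding pentagonal_coeff_sum
  proof (intro arg_cong2[of _ _ _ _ "(+)"] sum.cong refl)
    fix k assume "k \<in> {1..i}"
    hence k: "k > 0"
      by simp
    have "c (- int k) = (if i = k * (3 * k - 1) div 2 then (-1) ^ k else 0)"
      "c (int k) = (if i = k * (3 * k + 1) div 2 then (-1) ^ k else 0)"
      unfolding pentagonal_eq_iff(1) pentagonal_eq_iff(2)[OF k] by (simp_all add: c_def)
    thus "(-1) ^ k * ((if i = k * (3 * k - 1) div 2 then 1 else 0) + (if i = k * (3 * k + 1) div 2 then 1 else 0)) =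
        c (- int k) + c (int k)"
      by (simp only: ring_distribs if_distrib[of "\<lambda>x. _ * x"] mult_1_right mult_zero_right)
  qed (auto simp: c_def)
  also have "\<dots> = (\<Sum>k\<in>{0} \<union> (\<lambda>k. - int k) ` {1..i} \<union> int ` {1..i}. c k)"
    by (subst sum.union_disjoint, force, force, force)+
       (simp add: sum.reindex inj_on_def sum.distrib add_ac)
  also have "{0} \<union> (\<lambda>k. - int k) ` {1..i} \<union> int ` {1..i} = {- int i..int i}"
  proof (intro equalityI subsetI)
    fix x assume x: "x \<in> {- int i..int i}"
    have "x \<in> (\<lambda>k. - int k) ` {1..i}" if "x < 0"
      using x that by (intro image_eqI[of _ _ "nat (- x)"]) auto
    moreover have "x \<in> int ` {1..i}" if "x > 0"
      using x that by (intro image_eqI[of _ _ "nat x"]) auto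
    ultimately show "x \<in> {0} \<union> (\<lambda>k. - int k) ` {1..i} \<union> int ` {1..i}"
      by (cases x "0 :: int" rule: linorder_cases) auto
  qed auto
  finally have eq: "fps_nth (fps_euler :: 'a fps) i = (\<Sum>k=-int i..int i. c k)" .
  show "fps_nth (fps_euler :: 'a fps) i = 0" if "\<And>k. 2 * int i \<noteq> k * (3 * k + 1)"
    unfolding eq using that by (simp add: c_def)
  assume k: "2 * int i = k * (3 * k + 1)"
  have "k \<in> {- int i..int i}"
  proof -
    have "\<bar>k\<bar> * 2 \<le> \<bar>k\<bar> * \<bar>3 * k + 1\<bar>" if "k \<noteq> 0"
      using that by (intro mult_left_mono) auto
    hence "\<bar>k\<bar> * 2 \<le> \<bar>2 * int i\<bar>"
      unfolding k abs_mult by (cases "k = 0") auto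
    thus ?thesis
      by auto
  qed
  moreover have "c l = (if l = k then (-1) ^ nat \<bar>k\<bar> else 0)" for l
    using k pentagonal_inj[of k l] by (auto simp: c_def)
  ultimately show "fps_nth (fps_euler :: 'a fps) i = (-1) ^ nat \<bar>k\<bar>"
    unfolding eq by simp
qed

subsection \<open>The operators \<open>\<Omega>\<^sub>5\<^sub>,\<^sub>m\<close> on formal power series\<close>

definition fps_section :: "nat \<Rightarrow> 'a :: zero fps \<Rightarrow> 'a fps" where
  "fps_section m F = Abs_fps (\<lambda>n. fps_nth F (5 * n + m))"

definition pow5 :: "'a :: idom fps \<Rightarrow> 'a fps" where
  "pow5 F = F oo fps_X ^ 5"

lemma fps_section_nth [simp]: "fps_nth (fps_section m F) n = fps_nth F (5 * n + m)"
  by (simp add: fps_section_def)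

lemma fps_section_linear:
  "fps_section m (F + G) = fps_section m F + fps_section m G"
  "fps_section m (F - G) = fps_section m F - fps_section m G"
  "fps_section m (- F) = - fps_section m F"
  "fps_section m (numeral k * F) = numeral k * fps_section m F"
  for F G :: "'a :: comm_ring_1 fps"
  by (simp_all add: fps_eq_iff numeral_fps_const)

lemma pow5_nth: "fps_nth (pow5 F) n = (if 5 dvd n then fps_nth F (n div 5) else 0)"
  by (simp add: pow5_def fps_nth_compose_X_power)

lemma pow5_ring:
  "pow5 (F + G) = pow5 F + pow5 G"
  "pow5 (F - G) = pow5 F - pow5 G"
  "pow5 (- F) = - pow5 F"
  "pow5 (F * G) = pow5 F * pow5 G"
  "pow5 (F ^ n) = pow5 F ^ n"
  "pow5 1 = 1"
  "pow5 (numeral k) = numeral k"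
  "pow5 fps_X = fps_X ^ 5"
  by (simp_all add: pow5_def fps_compose_add_distrib fps_compose_sub_distrib fps_compose_uminus
      fps_compose_mult_distrib fps_compose_power)

lemma pow5_inject: "pow5 F = pow5 G \<longleftrightarrow> F = G"
proof
  assume "pow5 F = pow5 G"
  hence "fps_nth (pow5 F) (5 * n) = fps_nth (pow5 G) (5 * n)" for n
    by simp
  thus "F = G"
    by (simp add: fps_eq_iff pow5_nth)
qed auto

lemma fps_section_pow5_mult:
  assumes "m < 5"
  shows "fps_section m (pow5 F * G) = F * fps_section m G"
proof (rule fps_ext)
  fix n
  have "fps_nth (pow5 F * G) (5 * n + m) =
      (\<Sum>i=0..5*n+m. if 5 dvd i then fps_nth F (i div 5) * fps_nth G (5 * n + m - i) else 0)"
    by (auto simp: fps_mult_nth pow5_nth intro!: sum.cong)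
  also have "\<dots> = (\<Sum>i | i \<in> {0..5*n+m} \<and> 5 dvd i. fps_nth F (i div 5) * fps_nth G (5 * n + m - i))"
    by (subst sum.inter_filter) auto
  also have "\<dots> = (\<Sum>i=0..n. fps_nth F i * fps_nth G (5 * (n - i) + m))"
  proof (rule sum.reindex_bij_witness[of _ "\<lambda>i. 5 * i" "\<lambda>i. i div 5"])
    fix i assume "i \<in> {i \<in> {0..5*n+m}. 5 dvd i}"
    then obtain j where j: "i = 5 * j" "5 * j \<le> 5 * n + m"
      by auto
    with assms have "j \<le> n"
      by linarith
    with j show "i div 5 \<in> {0..n}"
      "fps_nth F (i div 5) * fps_nth G (5 * (n - i div 5) + m) = fps_nth F (i div 5) * fps_nth G (5 * n + m - i)"
      by (auto simp: diff_mult_distrib2)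
  qed auto
  finally show "fps_nth (fps_section m (pow5 F * G)) n = fps_nth (F * fps_section m G) n"
    by (simp add: fps_mult_nth)
qed

lemma fps_section_1: "fps_section m 1 = (if m = 0 then 1 else 0)"
  by (auto simp: fps_eq_iff)

lemma fps_section_X_power_mult:
  "k \<le> m \<Longrightarrow> fps_section m (fps_X ^ k * F) = fps_section (m - k) (F :: 'a :: comm_ring_1 fps)"
  by (simp add: fps_eq_iff fps_X_power_mult_nth)

lemma fps_section_X_mult: "fps_section 0 (fps_X * F) = fps_X * fps_section 4 (F :: 'a :: comm_ring_1 fps)"
proof (rule fps_ext)
  fix n
  show "fps_nth (fps_section 0 (fps_X * F)) n = fps_nth (fps_X * fps_section 4 F) n"
    by (cases n) (simp_all add: numeral_eq_Suc)
qed

lemma fps_section_monomial: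
  assumes "m < 5"
  shows "fps_section m (pow5 a ^ i * (fps_X * pow5 b) ^ j * (fps_X\<^sup>2 * pow5 c) ^ k) =
           (if (j + 2 * k) mod 5 = m then fps_X ^ ((j + 2 * k) div 5) * (a ^ i * b ^ j * c ^ k) else 0)"
proof -
  define r d where "r = (j + 2 * k) mod 5" and "d = (j + 2 * k) div 5"
  have r: "r < 5" "j + 2 * k = 5 * d + r"
    by (simp_all add: r_def d_def)
  have "a ^ i * (x * b) ^ j * (x\<^sup>2 * c) ^ k = (x ^ 5) ^ d * (a ^ i * b ^ j * c ^ k) * (x ^ r * 1)"
    for a b c x :: "'a fps"
  proof -
    have "a ^ i * (x * b) ^ j * (x\<^sup>2 * c) ^ k = x ^ (j + 2 * k) * (a ^ i * b ^ j * c ^ k)"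
      by (simp add: power_mult_distrib power_add mult_ac flip: power_mult)
    thus ?thesis
      unfolding r(2) by (simp add: power_add mult_ac flip: power_mult)
  qed
  hence "pow5 a ^ i * (fps_X * pow5 b) ^ j * (fps_X\<^sup>2 * pow5 c) ^ k =
      pow5 (fps_X ^ d * (a ^ i * b ^ j * c ^ k)) * (fps_X ^ r * 1)"
    by (simp only: pow5_ring)
  also have "fps_section m \<dots> = fps_X ^ d * (a ^ i * b ^ j * c ^ k) * fps_section m (fps_X ^ r * 1)"
    by (rule fps_section_pow5_mult[OF assms])
  also have "fps_section m (fps_X ^ r * 1) = (if r = m then 1 else (0 :: 'a fps))"
    using r(1) assms by (auto simp: fps_eq_iff fps_X_power_nth)
  finally show ?thesis
    by (simp add: r_def d_def)
qed

lemma fps_sections_eqI: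
  assumes "\<And>m. m < 5 \<Longrightarrow> fps_section m F = fps_section m G"
  shows "F = G"
proof (rule fps_ext)
  fix n
  have "fps_nth (fps_section (n mod 5) F) (n div 5) = fps_nth (fps_section (n mod 5) G) (n div 5)"
    by (simp add: assms)
  thus "fps_nth F n = fps_nth G n"
    by simp
qed

subsection \<open>The 5-dissection of Euler's function\<close>

lemma pentagonal_mod_5:
  fixes k :: int
  shows "(k * (3 * k + 1)) mod 5 \<in> {0, 2, 4}" and "(k * (3 * k + 1)) mod 5 = 2 \<longleftrightarrow> k mod 5 = 4"
proof -
  have "k mod 5 \<in> {0, 1, 2, 3, 4}"
    by auto
  moreover have "(k * (3 * k + 1)) mod 5 = ((k mod 5) * (3 * (k mod 5) + 1)) mod 5"
  proof -
    define a r where "a = k div 5" and "r = k mod 5"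
    have k: "k = 5 * a + r"
      by (simp add: a_def r_def)
    have "k * (3 * k + 1) = r * (3 * r + 1) + 5 * (a * (3 * k + 1) + 3 * r * a)"
      by (simp add: k algebra_simps)
    thus ?thesis
      unfolding r_def[symmetric] by (simp only: mod_mult_self2)
  qed
  ultimately show "(k * (3 * k + 1)) mod 5 \<in> {0, 2, 4}" "(k * (3 * k + 1)) mod 5 = 2 \<longleftrightarrow> k mod 5 = 4"
    by auto
qed

lemma fps_section_euler_34:
  assumes "m = 3 \<or> m = 4"
  shows "fps_section m fps_euler = (0 :: 'a :: comm_ring_1 fps)"
proof (rule fps_ext)
  fix n
  have "2 * int (5 * n + m) \<noteq> k * (3 * k + 1)" for k
    using pentagonal_mod_5(1)[of k] assms by auto presburger+
  thus "fps_nth (fps_section m fps_euler) n = fps_nth (0 :: 'a fps) n"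
    by (simp add: pentagonal_number_theorem(2))
qed

lemma fps_section_euler_1: "fps_section 1 fps_euler = - pow5 (fps_euler :: 'a :: idom fps)"
proof (rule fps_ext)
  fix n
  show "fps_nth (fps_section 1 fps_euler) n = fps_nth (- pow5 (fps_euler :: 'a fps)) n"
  proof (cases "\<exists>k. 2 * int (5 * n + 1) = k * (3 * k + 1)")
    case True
    then obtain k where k: "2 * int (5 * n + 1) = k * (3 * k + 1)"
      by blast
    have "(k * (3 * k + 1)) mod 5 = 2"
      unfolding k[symmetric] by presburger
    hence "k mod 5 = 4"
      by (simp add: pentagonal_mod_5)
    hence "k = -5 * (- (k div 5) - 1) - 1"
      using div_mult_mod_eq[of k 5] by simp
    then obtain j where j: "k = -5 * j - 1"
      by blast
    have "2 * int n = 5 * (j * (3 * j + 1))"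
      using k by (simp add: j algebra_simps)
    hence "5 dvd int n"
      by presburger
    then obtain m where m: "n = 5 * m"
      by (metis dvdE int_dvd_int_iff of_nat_numeral)
    have mj: "2 * int m = j * (3 * j + 1)"
      using \<open>2 * int n = _\<close> by (simp add: m)
    have "(-1) ^ nat \<bar>k\<bar> = (- ((-1) ^ nat \<bar>j\<bar>) :: 'a)"
    proof -
      have "even (nat \<bar>k\<bar>) \<longleftrightarrow> odd (nat \<bar>j\<bar>)"
        by (simp add: even_nat_iff j)
      thus ?thesis
        by (simp add: minus_one_power_iff)
    qed
    thus ?thesis
      using pentagonal_number_theorem(1)[OF k, where ?'a = 'a] pentagonal_number_theorem(1)[OF mj, where ?'a = 'a]
      by (simp add: pow5_nth m)
  next
    case False
    have "2 * int (n div 5) \<noteq> l * (3 * l + 1)" if "5 dvd n" for l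
    proof
      assume l: "2 * int (n div 5) = l * (3 * l + 1)"
      have "2 * int (5 * n + 1) = 25 * (2 * int (n div 5)) + 2"
        using that by auto
      also have "\<dots> = (-5 * l - 1) * (3 * (-5 * l - 1) + 1)"
        unfolding l by (simp add: algebra_simps)
      finally show False
        using False by blast
    qed
    hence "fps_nth (pow5 fps_euler) n = (0 :: 'a)"
      by (simp add: pow5_nth pentagonal_number_theorem(2))
    moreover have "fps_nth fps_euler (5 * n + 1) = (0 :: 'a)"
      using False by (intro pentagonal_number_theorem(2)) blast
    ultimately show ?thesis
      by simp
  qed
qed

abbreviation \<E> :: "complex fps" where "\<E> \<equiv> fps_euler"

lemma euler_dissection:
  "\<E> = pow5 (fps_section 0 \<E>) + fps_X * pow5 (- pow5 \<E>) + fps_X\<^sup>2 * pow5 (fps_section 2 \<E>)"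
proof (rule fps_sections_eqI)
  fix m :: nat assume m: "m < 5"
  have mono: "fps_section m (pow5 a) = (if m = 0 then a else 0)"
    "fps_section m (fps_X * pow5 a) = (if m = 1 then a else 0)"
    "fps_section m (fps_X\<^sup>2 * pow5 a) = (if m = 2 then a else 0)" for a :: "complex fps"
    using fps_section_monomial[OF m, of a 1 0 0 0 0] fps_section_monomial[OF m, of 0 0 a 1 0 0]
      fps_section_monomial[OF m, of 0 0 0 0 a 1] by auto
  from m have "m = 0 \<or> m = 1 \<or> m = 2 \<or> m = 3 \<or> m = 4"
    by auto
  thus "fps_section m \<E> = fps_section m (pow5 (fps_section 0 \<E>) + fps_X * pow5 (- pow5 \<E>) + fps_X\<^sup>2 * pow5 (fps_section 2 \<E>))"
    unfolding fps_section_linear mono using fps_section_euler_34[of m, where ?'a = complex] fps_section_euler_1[where ?'a = complex]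
    by auto
qed

subsection \<open>The norm of Euler's function\<close>

lemma prod_trinomial_root_unity5:
  fixes v A B C :: "'a :: idom"
  assumes "v ^ 4 = - 1 - v - v\<^sup>2 - v ^ 3" "v ^ 5 = 1"
  shows "(\<Prod>i<5. A + v ^ i * B + v ^ (2 * i) * C) =
           A ^ 5 + B ^ 5 + C ^ 5 - 5 * A * B ^ 3 * C + 5 * A\<^sup>2 * B * C\<^sup>2"
proof -
  have pw: "v ^ 6 = v" "v ^ 8 = v ^ 3"
    using assms(2) by algebra+
  have "(A + v * B + v\<^sup>2 * C) * (A + v ^ 4 * B + v ^ 3 * C) =
      A\<^sup>2 + B\<^sup>2 + C\<^sup>2 + (v + v ^ 4) * (A * B + B * C) + (v\<^sup>2 + v ^ 3) * A * C"
    using assms by algebra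
  moreover have "(A + v\<^sup>2 * B + v ^ 4 * C) * (A + v ^ 3 * B + v * C) =
      A\<^sup>2 + B\<^sup>2 + C\<^sup>2 + (v\<^sup>2 + v ^ 3) * (A * B + B * C) + (v + v ^ 4) * A * C"
    using assms by algebra
  moreover have "(\<Prod>i<5. A + v ^ i * B + v ^ (2 * i) * C) =
      (A + B + C) * ((A + v * B + v\<^sup>2 * C) * (A + v ^ 4 * B + v ^ 3 * C)) *
      ((A + v\<^sup>2 * B + v ^ 4 * C) * (A + v ^ 3 * B + v * C))"
    by (simp add: lessThan_5 pw mult_ac)
  moreover define s where "s = v + v ^ 4"
  moreover have "v\<^sup>2 + v ^ 3 = - 1 - s"
    using assms by (simp add: s_def)
  moreover have "s\<^sup>2 = 1 - s"
    using assms unfolding s_def by algebra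
  ultimately show ?thesis
    by algebra
qed

lemma has_fps_expansion_pow5:
  fixes f :: "complex \<Rightarrow> complex"
  assumes "f has_fps_expansion F"
  shows "(\<lambda>q. f (q ^ 5)) has_fps_expansion pow5 F"
  using has_fps_expansion_compose[OF assms has_fps_expansion_fps_X_power[of 5]]
  by (simp add: pow5_def o_def)

lemma has_fps_expansion_dilate:
  fixes f :: "complex \<Rightarrow> complex"
  assumes "f has_fps_expansion F"
  shows "(\<lambda>q. f (c * q)) has_fps_expansion (F oo (fps_const c * fps_X))"
  using has_fps_expansion_compose[OF assms, of "\<lambda>q. c * q" "fps_const c * fps_X"]
  by (simp add: o_def has_fps_expansion_cmult_left has_fps_expansion_fps_X)

lemma has_fps_expansion_eqI:
  fixes F G :: "complex fps"
  assumes "f has_fps_expansion F" "g has_fps_expansion G" "\<And>q. norm q < 1 \<Longrightarrow> f q = g q"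
  shows "F = G"
proof -
  have "\<forall>\<^sub>F q in nhds 0. f q = g q"
    using eventually_nhds_in_open[of "ball 0 1" "0 :: complex"] by (auto elim!: eventually_mono intro: assms(3))
  hence "f has_fps_expansion G"
    using assms(2) has_fps_expansion_cong by blast
  thus ?thesis
    using assms(1) fps_expansion_unique_complex by blast
qed

lemma pow5_dilate:
  assumes "c ^ 5 = 1"
  shows "pow5 F oo (fps_const c * fps_X) = pow5 F"
proof (rule fps_ext)
  fix n
  show "fps_nth (pow5 F oo (fps_const c * fps_X)) n = fps_nth (pow5 F) n"
    using assms by (auto simp: pow5_nth power_mult elim!: dvdE)
qed

lemma euler_norm:
  defines "A \<equiv> pow5 (fps_section 0 \<E>)" and "B \<equiv> fps_X * pow5 (- pow5 \<E>)" and "C \<equiv> fps_X\<^sup>2 * pow5 (fps_section 2 \<E>)"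
  shows "(A ^ 5 + B ^ 5 + C ^ 5 - 5 * A * B ^ 3 * C + 5 * A\<^sup>2 * B * C\<^sup>2) * pow5 (pow5 \<E>) = pow5 \<E> ^ 6"
proof -
  define v where "v = fps_const zeta5"
  have z5: "zeta5 ^ 5 = 1" "zeta5 \<noteq> 1"
    using zeta5_power_eq_1_iff[of 5] zeta5_power_eq_1_iff[of 1] by auto
  have v: "v ^ 4 = - 1 - v - v\<^sup>2 - v ^ 3" "v ^ 5 = 1"
    using root_unity5_sum[OF z5] z5 by (simp_all add: v_def fps_const_power flip: fps_const_1_eq_1)
  have "(\<lambda>q. (\<Prod>i<5. euler (zeta5 ^ i * q)) * euler ((q ^ 5) ^ 5)) has_fps_expansion
      ((\<Prod>i<5. \<E> oo (fps_const (zeta5 ^ i) * fps_X)) * pow5 (pow5 \<E>))"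
    by (intro fps_expansion_intros has_fps_expansion_dilate has_fps_expansion_pow5[of "\<lambda>q. euler (q ^ 5)"]
        has_fps_expansion_pow5[of euler])
  moreover have "(\<lambda>q. euler (q ^ 5) ^ 6) has_fps_expansion (pow5 \<E> ^ 6)"
    by (intro fps_expansion_intros has_fps_expansion_pow5[of euler])
  moreover have "(\<Prod>i<5. euler (zeta5 ^ i * q)) * euler ((q ^ 5) ^ 5) = euler (q ^ 5) ^ 6" if "norm q < 1" for q
    using prod_euler_zeta5[OF that] by (simp flip: power_mult)
  ultimately have eq: "(\<Prod>i<5. \<E> oo (fps_const (zeta5 ^ i) * fps_X)) * pow5 (pow5 \<E>) = pow5 \<E> ^ 6"
    by (rule has_fps_expansion_eqI)
  have "\<E> oo (fps_const (zeta5 ^ i) * fps_X) = A + v ^ i * B + v ^ (2 * i) * C" for i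
  proof -
    let ?y = "fps_const (zeta5 ^ i) * fps_X"
    have c: "(zeta5 ^ i) ^ 5 = 1"
      by (simp add: zeta5_power_eq_1_iff flip: power_mult)
    have y: "fps_nth ?y 0 = 0"
      by simp
    have "\<E> oo ?y = pow5 (fps_section 0 \<E>) + ?y * pow5 (- pow5 \<E>) + ?y\<^sup>2 * pow5 (fps_section 2 \<E>)"
      by (subst euler_dissection)
         (simp only: fps_compose_add_distrib fps_compose_mult_distrib[OF y] fps_compose_power[OF y, symmetric]
           pow5_dilate[OF c] fps_X_fps_compose_startby0[OF y])
    moreover have "fps_const (zeta5 ^ i) = v ^ i"
      by (simp add: v_def fps_const_power)
    ultimately show ?thesis
      by (simp add: A_def B_def C_def power_mult_distrib mult_ac flip: power_mult)
  qed
  thus ?thesis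
    using eq prod_trinomial_root_unity5[OF v, of A B C] by simp
qed

subsection \<open>Ramanujan's formula for \<open>p(5n+4)\<close>\<close>

abbreviation \<P> :: "complex fps" where "\<P> \<equiv> fps_partitions"

lemma E_mult_P: "\<E> * \<P> = 1"
  by (metis fps_partitions_mult_euler mult.commute)

lemma inverse_euler_has_fps_expansion [fps_expansion_intros]:
  "(\<lambda>q. inverse (euler q)) has_fps_expansion \<P>"
proof -
  have "inverse \<E> = \<P>"
    by (rule fps_inverse_unique) (rule E_mult_P)
  thus ?thesis
    using has_fps_expansion_inverse[OF euler_has_fps_expansion] by simp
qed

definition fps_L2 :: "complex fps" where
  "fps_L2 = fps_X * pow5 \<E> ^ 5 * \<P>"

lemma L2_eq_euler':
  assumes "norm q < 1"
  shows "L2 q = q * euler (q ^ 5) ^ 5 * inverse (euler q)"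
  using L2_eq_euler[OF assms] by (simp add: field_simps)

lemma L2_has_fps_expansion: "L2 has_fps_expansion fps_L2"
proof -
  have L2: "(\<lambda>q. q * euler (q ^ 5) ^ 5 * inverse (euler q)) has_fps_expansion fps_L2"
    unfolding fps_L2_def by (intro fps_expansion_intros has_fps_expansion_pow5[of euler])
  have ev: "\<forall>\<^sub>F q in nhds 0. q * euler (q ^ 5) ^ 5 * inverse (euler q) = L2 q"
    using eventually_nhds_in_open[of "ball 0 1" "0 :: complex"]
    by (auto elim!: eventually_mono simp: L2_eq_euler')
  show ?thesis
    using L2 by (subst (asm) has_fps_expansion_cong[OF ev refl])
qed

lemma norm_power5_less_1: "norm q < 1 \<Longrightarrow> norm (q ^ 5 :: complex) < 1"
  by (simp add: norm_power power_less_one_iff)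

lemma holomorphic_L2: "L2 holomorphic_on ball 0 1"
proof -
  have "(\<lambda>q. q * euler (q ^ 5) ^ 5 * inverse (euler q)) holomorphic_on ball 0 1"
    by (intro holomorphic_intros) (auto simp: euler_nonzero intro: norm_power5_less_1)
  thus ?thesis
    by (rule holomorphic_transform) (simp add: L2_eq_euler')
qed

lemma fps_section_L2: "fps_section 0 fps_L2 = 5 * fps_L2"
proof -
  have "(\<lambda>q. \<Sum>i<5. L2 (zeta5 ^ i * q)) has_fps_expansion (\<Sum>i<5. fps_L2 oo (fps_const (zeta5 ^ i) * fps_X))"
    by (intro fps_expansion_intros has_fps_expansion_dilate L2_has_fps_expansion)
  moreover have "(\<lambda>q. 25 * L2 (q ^ 5)) has_fps_expansion (25 * pow5 fps_L2)"
    by (intro fps_expansion_intros has_fps_expansion_pow5 L2_has_fps_expansion)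
  ultimately have eq: "(\<Sum>i<5. fps_L2 oo (fps_const (zeta5 ^ i) * fps_X)) = 25 * pow5 fps_L2"
    by (rule has_fps_expansion_eqI) (rule sum_L2_zeta5)
  show ?thesis
  proof (rule fps_ext)
    fix n
    have one: "(zeta5 ^ i) ^ (5 * n) = 1" for i
      using zeta5_power_eq_1_iff[of "i * (5 * n)"] by (simp flip: power_mult)
    have "fps_nth (\<Sum>i<5. fps_L2 oo (fps_const (zeta5 ^ i) * fps_X)) (5 * n) = fps_nth (25 * pow5 fps_L2) (5 * n)"
      by (simp only: eq)
    thus "fps_nth (fps_section 0 fps_L2) n = fps_nth (5 * fps_L2) n"
      by (simp add: fps_sum_nth one numeral_fps_const pow5_nth)
  qed
qed

theorem fps_section_partitions: "fps_section 4 \<P> = 5 * pow5 \<E> ^ 5 * \<P> ^ 6"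
proof -
  have "fps_section 0 fps_L2 = fps_section 0 (pow5 (\<E> ^ 5) * (fps_X * \<P>))"
    by (simp add: fps_L2_def pow5_ring mult_ac)
  also have "\<dots> = \<E> ^ 5 * (fps_X * fps_section 4 \<P>)"
    by (simp add: fps_section_pow5_mult fps_section_X_mult)
  finally have "fps_X * (\<E> ^ 5 * fps_section 4 \<P>) = fps_X * (5 * pow5 \<E> ^ 5 * \<P>)"
    unfolding fps_section_L2 by (simp add: fps_L2_def mult_ac)
  hence "\<E> ^ 5 * fps_section 4 \<P> = 5 * pow5 \<E> ^ 5 * \<P>"
    by simp
  hence "(\<E> * \<P>) ^ 5 * fps_section 4 \<P> = 5 * pow5 \<E> ^ 5 * \<P> ^ 6"
    by (simp add: power_mult_distrib eval_nat_numeral mult_ac)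
  thus ?thesis
    by (simp add: E_mult_P)
qed

subsection \<open>Ramanujan's formula for \<open>p(25n+24)\<close>\<close>

abbreviation \<alpha> :: "complex fps" where "\<alpha> \<equiv> fps_section 0 \<E>"
abbreviation \<beta> :: "complex fps" where "\<beta> \<equiv> fps_section 2 \<E>"
abbreviation \<epsilon> :: "complex fps" where "\<epsilon> \<equiv> pow5 \<E>"

definition euler_part0 :: "complex fps" ("\<A>") where "\<A> = pow5 \<alpha>"
definition euler_part1 :: "complex fps" ("\<B>") where "\<B> = fps_X * pow5 (- \<epsilon>)"
definition euler_part2 :: "complex fps" ("\<C>") where "\<C> = fps_X\<^sup>2 * pow5 \<beta>"
definition euler_norm_form :: "complex fps" ("\<N>") where
  "\<N> = \<A> ^ 5 + \<B> ^ 5 + \<C> ^ 5 - 5 * \<A> * \<B> ^ 3 * \<C> + 5 * \<A>\<^sup>2 * \<B> * \<C>\<^sup>2"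

lemma eps_nonzero [simp]: "\<epsilon> \<noteq> 0"
  using pow5_inject[of \<E> 0] by (auto simp: pow5_def)

lemma E_eq: "\<E> = \<A> + \<B> + \<C>"
  using euler_dissection by (simp add: euler_part0_def euler_part1_def euler_part2_def)

lemma N_eq: "\<N> * pow5 \<epsilon> = pow5 \<E> ^ 6"
  using euler_norm by (simp add: euler_norm_form_def euler_part0_def euler_part1_def euler_part2_def)

lemmas section_ABC = fps_section_monomial[of _ \<alpha> _ "- \<epsilon>" _ \<beta>, folded euler_part0_def euler_part1_def euler_part2_def]

text \<open>
  \<open>Q\<close> below is the product of the four conjugates of \<open>\<E>\<close>. Its section 4 is known from the formula for \<open>p(5n+4)\<close>,
  which gives a quadratic equation for \<open>\<alpha> \<beta>\<close>; the constant coefficients select the root.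
\<close>
lemma alpha_beta: "\<alpha> * \<beta> = - (\<epsilon>\<^sup>2)"
proof -
  define Q where "Q = \<A>^4*\<B>^0*\<C>^0 - \<A>^3*\<B>^1*\<C>^0 - \<A>^3*\<B>^0*\<C>^1 + \<A>^2*\<B>^2*\<C>^0 + 2*(\<A>^2*\<B>^1*\<C>^1) + \<A>^2*\<B>^0*\<C>^2
     - \<A>^1*\<B>^3*\<C>^0 - 3*(\<A>^1*\<B>^2*\<C>^1) + 2*(\<A>^1*\<B>^1*\<C>^2) - \<A>^1*\<B>^0*\<C>^3 + \<A>^0*\<B>^4*\<C>^0 - \<A>^0*\<B>^3*\<C>^1 + \<A>^0*\<B>^2*\<C>^2
     - \<A>^0*\<B>^1*\<C>^3 + \<A>^0*\<B>^0*\<C>^4"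
  have "\<N> = \<E> * Q"
    unfolding E_eq euler_norm_form_def Q_def by (simp only: power_0 power_one_right mult_1_right mult_1_left) algebra
  hence Q: "Q = \<N> * \<P>"
    using E_mult_P by (metis mult.assoc mult.commute mult_1_right)
  have "fps_section 4 Q = \<epsilon> ^ 4 - 3 * (\<alpha> * \<epsilon>\<^sup>2 * \<beta>) + \<alpha>\<^sup>2 * \<beta>\<^sup>2"
  proof -
    have "4 < (5 :: nat)"
      by simp
    thus ?thesis
      unfolding Q_def fps_section_linear by (simp only: section_ABC) simp
  qed
  moreover have "fps_section 4 Q = \<epsilon> ^ 4 * 5"
  proof -
    have "pow5 \<epsilon> * Q = pow5 (\<E> ^ 6) * \<P>"
      unfolding Q using N_eq by (simp add: pow5_ring mult_ac)
    hence "fps_section 4 (pow5 \<epsilon> * Q) = fps_section 4 (pow5 (\<E> ^ 6) * \<P>)"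
      by simp
    hence "\<epsilon> * fps_section 4 Q = \<E> ^ 6 * (5 * \<epsilon> ^ 5 * \<P> ^ 6)"
      by (simp add: fps_section_pow5_mult fps_section_partitions)
    also have "\<dots> = (\<E> * \<P>) ^ 6 * (5 * \<epsilon> ^ 5)"
      by (simp only: power_mult_distrib mult_ac)
    also have "\<dots> = \<epsilon> * (\<epsilon> ^ 4 * 5)"
      by (simp add: E_mult_P eval_nat_numeral)
    finally show ?thesis
      by simp
  qed
  ultimately have "(\<alpha> * \<beta> - 4 * \<epsilon>\<^sup>2) * (\<alpha> * \<beta> + \<epsilon>\<^sup>2) = 0"
    by algebra
  moreover have "\<alpha> * \<beta> - 4 * \<epsilon>\<^sup>2 \<noteq> 0"
  proof
    assume "\<alpha> * \<beta> - 4 * \<epsilon>\<^sup>2 = 0"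
    hence "fps_nth (\<alpha> * \<beta> - 4 * \<epsilon>\<^sup>2) 0 = 0"
      by simp
    moreover have "fps_nth \<E> 2 = -1"
      using pentagonal_number_theorem(1)[of 2 1, where ?'a = complex] by simp
    ultimately show False
      by (simp add: pow5_nth fps_power_zeroth numeral_2_eq_2)
  qed
  ultimately show ?thesis
    by (simp add: eq_neg_iff_add_eq_0)
qed

definition euler_ratio :: "complex fps" ("\<w>") where "\<w> = - \<B> * \<P>"

definition euler_ratio_norm :: "complex fps" ("\<t>") where "\<t> = fps_X * \<epsilon> ^ 6 * \<P> ^ 6"

lemma AC: "\<A> * \<C> = - (\<B>\<^sup>2)"
proof -
  have "\<A> * \<C> = fps_X\<^sup>2 * pow5 (\<alpha> * \<beta>)"
    by (simp add: euler_part0_def euler_part2_def pow5_ring mult_ac)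
  thus ?thesis
    by (simp add: alpha_beta euler_part1_def pow5_ring power_mult_distrib)
qed

text \<open>With \<open>c = - \<B>\<close> this is the quintic equation of \<open>\<E> / c\<close> over the power series in \<open>X ^ 5\<close>.\<close>
lemma quintic: "\<E> ^ 5 - 5 * \<B> * \<E> ^ 4 + 15 * \<B>\<^sup>2 * \<E> ^ 3 - 25 * \<B> ^ 3 * \<E>\<^sup>2 + 25 * \<B> ^ 4 * \<E> = \<N>"
  using AC unfolding E_eq euler_norm_form_def by algebra

lemma t_N: "pow5 \<t> * \<N> = - (\<B> ^ 5)"
proof -
  have "pow5 \<t> * \<N> = fps_X ^ 5 * pow5 \<epsilon> ^ 5 * (\<N> * pow5 \<epsilon>) * pow5 \<P> ^ 6"
    by (simp add: euler_ratio_norm_def pow5_ring eval_nat_numeral mult_ac)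
  also have "\<dots> = fps_X ^ 5 * pow5 \<epsilon> ^ 5 * pow5 ((\<E> * \<P>) ^ 6)"
    by (simp add: N_eq pow5_ring power_mult_distrib mult_ac)
  also have "\<dots> = - (\<B> ^ 5)"
    by (simp add: E_mult_P pow5_ring euler_part1_def power_mult_distrib)
  finally show ?thesis .
qed

lemma E_P_cancel: "\<E> ^ i * \<P> ^ (i + k) = \<P> ^ k" "\<E> ^ (i + k) * \<P> ^ i = \<E> ^ k"
proof -
  have "\<E> ^ i * \<P> ^ i = 1"
    by (simp add: E_mult_P flip: power_mult_distrib)
  thus "\<E> ^ i * \<P> ^ (i + k) = \<P> ^ k" "\<E> ^ (i + k) * \<P> ^ i = \<E> ^ k"
    by (simp_all add: power_add mult_ac)
qed

lemma N_P_power: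
  "\<N> * \<P> ^ k = \<E> ^ 5 * \<P> ^ k - 5 * (\<B> * (\<E> ^ 4 * \<P> ^ k)) + 15 * (\<B>\<^sup>2 * (\<E> ^ 3 * \<P> ^ k))
     - 25 * (\<B> ^ 3 * (\<E>\<^sup>2 * \<P> ^ k)) + 25 * (\<B> ^ 4 * (\<E> * \<P> ^ k))"
  unfolding quintic[symmetric] by (simp only: ring_distribs mult_ac)

lemma B5_P_power: "\<B> ^ 5 * \<P> ^ k = - (pow5 \<t> * (\<N> * \<P> ^ k))"
  using t_N by (simp flip: mult.assoc)

lemma quintic_w: "\<w> ^ 5 = pow5 \<t> * (1 + 5 * \<w> + 15 * \<w>\<^sup>2 + 25 * \<w> ^ 3 + 25 * \<w> ^ 4)"
proof -
  have "\<w> ^ 5 = pow5 \<t> * (\<N> * \<P> ^ 5)"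
    using B5_P_power[of 5] by (simp add: euler_ratio_def power_mult_distrib)
  also have "\<N> * \<P> ^ 5 = 1 + 5 * \<w> + 15 * \<w>\<^sup>2 + 25 * \<w> ^ 3 + 25 * \<w> ^ 4"
    unfolding N_P_power using E_P_cancel(1)[of 5 0] E_P_cancel(1)[of 4 1] E_P_cancel(1)[of 3 2] E_P_cancel(1)[of 2 3] E_P_cancel(1)[of 1 4]
    by (simp add: euler_ratio_def power_mult_distrib)
  finally show ?thesis .
qed

lemma B_w:
  "\<B> ^ 3 * \<w>\<^sup>2 = pow5 \<t> * (- (\<E> ^ 3) + 5 * (\<B> * \<E>\<^sup>2) - 15 * (\<B>\<^sup>2 * \<E>) + 25 * \<B> ^ 3 + 25 * (\<B> ^ 3 * \<w>))"
  "\<B>\<^sup>2 * \<w> ^ 3 = pow5 \<t> * (\<E>\<^sup>2 - 5 * (\<B> * \<E>) + 15 * \<B>\<^sup>2 + 25 * (\<B>\<^sup>2 * \<w>) + 25 * (\<B>\<^sup>2 * \<w>\<^sup>2))"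
  "\<B> * \<w> ^ 4 = pow5 \<t> * (- \<E> + 5 * \<B> + 15 * (\<B> * \<w>) + 25 * (\<B> * \<w>\<^sup>2) + 25 * (\<B> * \<w> ^ 3))"
proof -
  have "\<B> ^ 3 * \<w>\<^sup>2 = \<B> ^ 5 * \<P>\<^sup>2" "\<B>\<^sup>2 * \<w> ^ 3 = - (\<B> ^ 5 * \<P> ^ 3)" "\<B> * \<w> ^ 4 = \<B> ^ 5 * \<P> ^ 4"
    by (simp_all add: euler_ratio_def power_mult_distrib eval_nat_numeral mult_ac)
  moreover have "\<N> * \<P>\<^sup>2 = \<E> ^ 3 - 5 * (\<B> * \<E>\<^sup>2) + 15 * (\<B>\<^sup>2 * \<E>) - 25 * \<B> ^ 3 - 25 * (\<B> ^ 3 * \<w>)"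
  proof -
    have "\<E> ^ 5 * \<P>\<^sup>2 = \<E> ^ 3" "\<E> ^ 4 * \<P>\<^sup>2 = \<E>\<^sup>2" "\<E> ^ 3 * \<P>\<^sup>2 = \<E>" "\<E>\<^sup>2 * \<P>\<^sup>2 = 1"
      using E_P_cancel(2)[of 2 3] E_P_cancel(2)[of 2 2] E_P_cancel(2)[of 2 1] E_P_cancel(1)[of 2 0]
      by simp_all
    moreover have "\<E> * \<P>\<^sup>2 = \<P>"
      using E_P_cancel(1)[of 1 1] by (simp only: power_one_right one_add_one)
    ultimately show ?thesis
      unfolding N_P_power by (simp only: euler_ratio_def) (simp add: eval_nat_numeral mult_ac)
  qed
  moreover have "\<N> * \<P> ^ 3 = \<E>\<^sup>2 - 5 * (\<B> * \<E>) + 15 * \<B>\<^sup>2 + 25 * (\<B>\<^sup>2 * \<w>) + 25 * (\<B>\<^sup>2 * \<w>\<^sup>2)"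
    unfolding N_P_power using E_P_cancel(2)[of 3 2] E_P_cancel(2)[of 3 1] E_P_cancel(2)[of 3 0] E_P_cancel(1)[of 2 1] E_P_cancel(1)[of 1 2]
    by (simp add: euler_ratio_def power_mult_distrib) (simp add: eval_nat_numeral mult_ac)
  moreover have "\<N> * \<P> ^ 4 = \<E> - 5 * \<B> - 15 * (\<B> * \<w>) - 25 * (\<B> * \<w>\<^sup>2) - 25 * (\<B> * \<w> ^ 3)"
    unfolding N_P_power using E_P_cancel(2)[of 4 1] E_P_cancel(2)[of 4 0] E_P_cancel(1)[of 3 1] E_P_cancel(1)[of 2 2] E_P_cancel(1)[of 1 3]
    by (simp add: euler_ratio_def power_mult_distrib) (simp add: eval_nat_numeral mult_ac)
  ultimately show
    "\<B> ^ 3 * \<w>\<^sup>2 = pow5 \<t> * (- (\<E> ^ 3) + 5 * (\<B> * \<E>\<^sup>2) - 15 * (\<B>\<^sup>2 * \<E>) + 25 * \<B> ^ 3 + 25 * (\<B> ^ 3 * \<w>))"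
    "\<B>\<^sup>2 * \<w> ^ 3 = pow5 \<t> * (\<E>\<^sup>2 - 5 * (\<B> * \<E>) + 15 * \<B>\<^sup>2 + 25 * (\<B>\<^sup>2 * \<w>) + 25 * (\<B>\<^sup>2 * \<w>\<^sup>2))"
    "\<B> * \<w> ^ 4 = pow5 \<t> * (- \<E> + 5 * \<B> + 15 * (\<B> * \<w>) + 25 * (\<B> * \<w>\<^sup>2) + 25 * (\<B> * \<w> ^ 3))"
    by (simp_all only: B5_P_power) (simp_all add: ring_distribs)
qed

definition ratio_power_section :: "nat \<Rightarrow> complex fps" ("\<S>") where "\<S> n = fps_section 0 (\<w> ^ n)"

lemma S_0: "\<S> 0 = 1"
  by (simp add: ratio_power_section_def fps_section_1)

lemma S_rec: "\<S> (n + 5) = \<t> * (\<S> n + 5 * \<S> (n + 1) + 15 * \<S> (n + 2) + 25 * \<S> (n + 3) + 25 * \<S> (n + 4))"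
proof -
  have "\<w> ^ (n + 5) = pow5 \<t> * (\<w> ^ n + 5 * \<w> ^ (n + 1) + 15 * \<w> ^ (n + 2) + 25 * \<w> ^ (n + 3) + 25 * \<w> ^ (n + 4))"
    unfolding power_add quintic_w by (simp add: algebra_simps)
  thus ?thesis
    by (simp add: ratio_power_section_def fps_section_pow5_mult fps_section_linear)
qed

lemma S_1: "\<S> 1 = 5 * \<t>"
proof -
  have "\<S> 1 = fps_section 0 (pow5 \<epsilon> * (fps_X * \<P>))"
    by (simp add: ratio_power_section_def euler_ratio_def euler_part1_def pow5_ring mult_ac)
  also have "\<dots> = \<epsilon> * (fps_X * fps_section 4 \<P>)"
    by (simp add: fps_section_pow5_mult fps_section_X_mult)
  also have "\<dots> = 5 * \<t>"
    unfolding fps_section_partitions euler_ratio_norm_def by (simp add: eval_nat_numeral mult_ac)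
  finally show ?thesis .
qed

lemma section_B_mult':
  assumes "k \<le> m" "m < 5"
  shows "fps_section m (\<B> ^ k * F) = (- \<epsilon>) ^ k * fps_section (m - k) F"
proof -
  have "\<B> ^ k * F = pow5 ((- \<epsilon>) ^ k) * (fps_X ^ k * F)"
    by (simp only: euler_part1_def pow5_ring(5) power_mult_distrib mult_ac)
  thus ?thesis
    using assms by (simp only: fps_section_pow5_mult fps_section_X_power_mult)
qed

lemma section_euler_powers:
  "fps_section 1 \<E> = - \<epsilon>" "fps_section 2 (\<E>\<^sup>2) = - (\<epsilon>\<^sup>2)" "fps_section 3 (\<E> ^ 3) = 5 * \<epsilon> ^ 3"
proof -
  have lt: "2 < (5 :: nat)" "3 < (5 :: nat)"
    by simp_all
  show "fps_section 1 \<E> = - \<epsilon>"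
    by (rule fps_section_euler_1)
  have "\<E>\<^sup>2 = \<A>^2*\<B>^0*\<C>^0 + \<A>^0*\<B>^2*\<C>^0 + \<A>^0*\<B>^0*\<C>^2 + 2*(\<A>^1*\<B>^1*\<C>^0)
      + 2*(\<A>^1*\<B>^0*\<C>^1) + 2*(\<A>^0*\<B>^1*\<C>^1)"
    unfolding E_eq by (simp add: power2_eq_square algebra_simps)
  hence "fps_section 2 (\<E>\<^sup>2) = \<epsilon>\<^sup>2 + 2 * (\<alpha> * \<beta>)"
    using lt by (simp only: fps_section_linear section_ABC) simp
  thus "fps_section 2 (\<E>\<^sup>2) = - (\<epsilon>\<^sup>2)"
    by (simp add: alpha_beta)
  have "\<E> ^ 3 = \<A>^3*\<B>^0*\<C>^0 + \<A>^0*\<B>^3*\<C>^0 + \<A>^0*\<B>^0*\<C>^3 + 3*(\<A>^2*\<B>^1*\<C>^0) + 3*(\<A>^2*\<B>^0*\<C>^1)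
      + 3*(\<A>^1*\<B>^2*\<C>^0) + 3*(\<A>^0*\<B>^2*\<C>^1) + 3*(\<A>^1*\<B>^0*\<C>^2) + 3*(\<A>^0*\<B>^1*\<C>^2) + 6*(\<A>^1*\<B>^1*\<C>^1)"
    unfolding E_eq by (simp add: power2_eq_square power3_eq_cube algebra_simps)
  hence "fps_section 3 (\<E> ^ 3) = - (\<epsilon> ^ 3) - 6 * (\<epsilon> * (\<alpha> * \<beta>))"
    using lt by (simp only: fps_section_linear section_ABC) (simp add: mult_ac)
  thus "fps_section 3 (\<E> ^ 3) = 5 * \<epsilon> ^ 3"
    by (simp add: alpha_beta power2_eq_square power3_eq_cube)
qed

lemma section_w:
  "fps_section 0 \<w> = \<S> 1" "fps_section 0 (\<w>\<^sup>2) = \<S> 2" "fps_section 0 (\<w> ^ 3) = \<S> 3" "fps_section 0 (\<w> ^ 4) = \<S> 4"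
  by (simp_all add: ratio_power_section_def)

lemma S_2: "\<S> 2 = 10 * \<t> + 125 * \<t>\<^sup>2"
proof -
  have "fps_section 3 (\<B> ^ 3 * \<w>\<^sup>2) = \<t> * (- fps_section 3 (\<E> ^ 3) + 5 * fps_section 3 (\<B> * \<E>\<^sup>2)
      - 15 * fps_section 3 (\<B>\<^sup>2 * \<E>) + 25 * fps_section 3 (\<B> ^ 3 * 1) + 25 * fps_section 3 (\<B> ^ 3 * \<w>))"
    unfolding B_w(1) by (simp add: fps_section_pow5_mult fps_section_linear)
  also have "fps_section 3 (\<B> * \<E>\<^sup>2) = \<epsilon> ^ 3"
    using section_B_mult'[of 1 3 "\<E>\<^sup>2"] section_euler_powers(2) by (simp add: eval_nat_numeral)
  also have "fps_section 3 (\<B>\<^sup>2 * \<E>) = - (\<epsilon> ^ 3)"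
    using section_B_mult'[of 2 3 \<E>] section_euler_powers(1) by (simp add: eval_nat_numeral)
  finally have S2: "fps_section 3 (\<B> ^ 3 * \<w>\<^sup>2) = \<t> * (- fps_section 3 (\<E> ^ 3) + 5 * \<epsilon> ^ 3 - 15 * (- (\<epsilon> ^ 3))
      + 25 * fps_section 3 (\<B> ^ 3 * 1) + 25 * fps_section 3 (\<B> ^ 3 * \<w>))" .
  have B: "fps_section 3 (\<B> ^ 3 * F) = - (\<epsilon> ^ 3) * fps_section 0 F" for F
    using section_B_mult'[of 3 3 F] by simp
  have "\<epsilon> ^ 3 * \<S> 2 = \<epsilon> ^ 3 * (10 * \<t> + 125 * \<t>\<^sup>2)"
    using S2 unfolding B section_euler_powers(3) fps_section_1 if_P[OF refl] section_w S_1 by algebra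
  thus ?thesis
    by simp
qed

lemma S_3: "\<S> 3 = 9 * \<t> + 375 * \<t>\<^sup>2 + 3125 * \<t> ^ 3"
proof -
  have "fps_section 2 (\<B>\<^sup>2 * \<w> ^ 3) = \<t> * (fps_section 2 (\<E>\<^sup>2) - 5 * fps_section 2 (\<B> * \<E>)
      + 15 * fps_section 2 (\<B>\<^sup>2 * 1) + 25 * fps_section 2 (\<B>\<^sup>2 * \<w>) + 25 * fps_section 2 (\<B>\<^sup>2 * \<w>\<^sup>2))"
    unfolding B_w(2) by (simp add: fps_section_pow5_mult fps_section_linear)
  also have "fps_section 2 (\<B> * \<E>) = \<epsilon>\<^sup>2"
    using section_B_mult'[of 1 2 \<E>] section_euler_powers(1) by (simp add: power2_eq_square)
  finally have S3: "fps_section 2 (\<B>\<^sup>2 * \<w> ^ 3) = \<t> * (fps_section 2 (\<E>\<^sup>2) - 5 * \<epsilon>\<^sup>2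
      + 15 * fps_section 2 (\<B>\<^sup>2 * 1) + 25 * fps_section 2 (\<B>\<^sup>2 * \<w>) + 25 * fps_section 2 (\<B>\<^sup>2 * \<w>\<^sup>2))" .
  have B: "fps_section 2 (\<B>\<^sup>2 * F) = \<epsilon>\<^sup>2 * fps_section 0 F" for F
    using section_B_mult'[of 2 2 F] by simp
  have "\<epsilon>\<^sup>2 * \<S> 3 = \<epsilon>\<^sup>2 * (9 * \<t> + 375 * \<t>\<^sup>2 + 3125 * \<t> ^ 3)"
    using S3 unfolding B section_euler_powers(2) fps_section_1 if_P[OF refl] section_w S_1 S_2 by algebra
  thus ?thesis
    by simp
qed

lemma S_4: "\<S> 4 = 4 * \<t> + 550 * \<t>\<^sup>2 + 12500 * \<t> ^ 3 + 78125 * \<t> ^ 4"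
proof -
  have S4: "fps_section 1 (\<B> * \<w> ^ 4) = \<t> * (- fps_section 1 \<E> + 5 * fps_section 1 (\<B> * 1)
      + 15 * fps_section 1 (\<B> * \<w>) + 25 * fps_section 1 (\<B> * \<w>\<^sup>2) + 25 * fps_section 1 (\<B> * \<w> ^ 3))"
    unfolding B_w(3) by (simp add: fps_section_pow5_mult fps_section_linear)
  have B: "fps_section 1 (\<B> * F) = - \<epsilon> * fps_section 0 F" for F
    using section_B_mult'[of 1 1 F] by simp
  have "\<epsilon> * \<S> 4 = \<epsilon> * (4 * \<t> + 550 * \<t>\<^sup>2 + 12500 * \<t> ^ 3 + 78125 * \<t> ^ 4)"
    using S4 unfolding B section_euler_powers(1) fps_section_1 if_P[OF refl] section_w S_1 S_2 S_3 by algebra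
  thus ?thesis
    by simp
qed

lemma S_6: "5 * \<S> 6 = 5\<^sup>2 * 63 * \<t>\<^sup>2 + 5 ^ 5 * 52 * \<t> ^ 3 + 5 ^ 7 * 63 * \<t> ^ 4 + 5 ^ 10 * 6 * \<t> ^ 5 + 5 ^ 12 * \<t> ^ 6"
proof -
  have "\<S> 5 = \<t> * (1 + 5 * \<S> 1 + 15 * \<S> 2 + 25 * \<S> 3 + 25 * \<S> 4)"
    using S_rec[of 0] S_0 by (simp add: eval_nat_numeral)
  moreover have "\<S> 6 = \<t> * (\<S> 1 + 5 * \<S> 2 + 15 * \<S> 3 + 25 * \<S> 4 + 25 * \<S> 5)"
    using S_rec[of 1] by (simp add: eval_nat_numeral)
  ultimately show ?thesis
    unfolding S_1 S_2 S_3 S_4 by algebra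
qed

theorem fps_section_section_partitions:
  "fps_section 4 (fps_section 4 \<P>) = 5\<^sup>2 * 63 * (\<epsilon> ^ 6 * \<P> ^ 7) + 5 ^ 5 * 52 * (fps_X * \<epsilon> ^ 12 * \<P> ^ 13)
     + 5 ^ 7 * 63 * (fps_X\<^sup>2 * \<epsilon> ^ 18 * \<P> ^ 19) + 5 ^ 10 * 6 * (fps_X ^ 3 * \<epsilon> ^ 24 * \<P> ^ 25)
     + 5 ^ 12 * (fps_X ^ 4 * \<epsilon> ^ 30 * \<P> ^ 31)"
proof -
  define H where "H = fps_section 4 (\<P> ^ 6)"
  have "\<w> ^ 6 = pow5 (fps_X * \<epsilon> ^ 6) * (fps_X * \<P> ^ 6)"
    by (simp add: euler_ratio_def euler_part1_def pow5_ring power_mult_distrib eval_nat_numeral mult_ac)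
  hence "\<S> 6 = fps_section 0 (pow5 (fps_X * \<epsilon> ^ 6) * (fps_X * \<P> ^ 6))"
    by (simp only: ratio_power_section_def)
  also have "\<dots> = fps_X * \<epsilon> ^ 6 * (fps_X * H)"
    by (simp add: fps_section_pow5_mult fps_section_X_mult H_def)
  finally have S6: "\<S> 6 = fps_X\<^sup>2 * \<epsilon> ^ 6 * H"
    by (simp add: power2_eq_square mult_ac)
  have "fps_section 4 \<P> = 5 * (pow5 (\<E> ^ 5) * \<P> ^ 6)"
    by (simp add: fps_section_partitions pow5_ring mult_ac)
  hence "fps_section 4 (fps_section 4 \<P>) = 5 * (\<E> ^ 5 * H)"
    by (simp add: fps_section_linear fps_section_pow5_mult H_def)
  hence "fps_X\<^sup>2 * \<epsilon> ^ 6 * fps_section 4 (fps_section 4 \<P>) = \<E> ^ 5 * (5 * \<S> 6)"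
    by (simp add: S6 mult_ac)
  also have "\<dots> = fps_X\<^sup>2 * \<epsilon> ^ 6 * (5\<^sup>2 * 63 * (\<epsilon> ^ 6 * (\<E> ^ 5 * \<P> ^ (5 + 7))) + 5 ^ 5 * 52 * (fps_X * \<epsilon> ^ 12 * (\<E> ^ 5 * \<P> ^ (5 + 13)))
     + 5 ^ 7 * 63 * (fps_X\<^sup>2 * \<epsilon> ^ 18 * (\<E> ^ 5 * \<P> ^ (5 + 19))) + 5 ^ 10 * 6 * (fps_X ^ 3 * \<epsilon> ^ 24 * (\<E> ^ 5 * \<P> ^ (5 + 25)))
     + 5 ^ 12 * (fps_X ^ 4 * \<epsilon> ^ 30 * (\<E> ^ 5 * \<P> ^ (5 + 31))))"
  proof -
    have "x * (c2 * (X * e * p)\<^sup>2 + c3 * (X * e * p) ^ 3 + c4 * (X * e * p) ^ 4 + c5 * (X * e * p) ^ 5 + c6 * (X * e * p) ^ 6) =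
        X\<^sup>2 * e * (c2 * (e * (x * p\<^sup>2)) + c3 * (X * e\<^sup>2 * (x * p ^ 3)) + c4 * (X\<^sup>2 * e ^ 3 * (x * p ^ 4))
          + c5 * (X ^ 3 * e ^ 4 * (x * p ^ 5)) + c6 * (X ^ 4 * e ^ 5 * (x * p ^ 6)))"
      for x X e p c2 c3 c4 c5 c6 :: "complex fps"
      by algebra
    from this[of "\<E> ^ 5" "5\<^sup>2 * 63" fps_X "\<epsilon> ^ 6" "\<P> ^ 6" "5 ^ 5 * 52" "5 ^ 7 * 63" "5 ^ 10 * 6" "5 ^ 12"]
    show ?thesis
      unfolding S_6 euler_ratio_norm_def by (simp only: power_mult[symmetric]) simp
  qed
  finally show ?thesis
    unfolding E_P_cancel(1) by (subst (asm) mult_cancel_left) (auto simp: fps_X_neq_zero)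
qed

subsection \<open>The analytic identities\<close>

lemma fps_section_section_nth:
  "fps_nth (fps_section 4 (fps_section 4 \<P>)) n = of_nat (num_partitions (25 * int n + 24))"
  by (simp add: fps_partitions_def algebra_simps)

theorem ramanujan_expansion_holds: "ramanujan_expansion"
  unfolding ramanujan_expansion_def euler_def[symmetric]
proof (intro allI impI)
  fix q :: complex assume q: "norm q < 1"
  define R where "R = (\<lambda>q. 5\<^sup>2 * 63 * (euler (q ^ 5) ^ 6 * inverse (euler q) ^ 7)
     + 5 ^ 5 * 52 * (q * euler (q ^ 5) ^ 12 * inverse (euler q) ^ 13)
     + 5 ^ 7 * 63 * (q\<^sup>2 * euler (q ^ 5) ^ 18 * inverse (euler q) ^ 19)
     + 5 ^ 10 * 6 * (q ^ 3 * euler (q ^ 5) ^ 24 * inverse (euler q) ^ 25)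
     + 5 ^ 12 * (q ^ 4 * euler (q ^ 5) ^ 30 * inverse (euler q) ^ 31))"
  have "R has_fps_expansion fps_section 4 (fps_section 4 \<P>)"
    unfolding R_def fps_section_section_partitions
    by (intro fps_expansion_intros has_fps_expansion_pow5[of euler])
  moreover have "R holomorphic_on eball 0 1"
    unfolding R_def one_ereal_def eball_ereal
    by (intro holomorphic_intros) (auto simp: euler_nonzero intro: norm_power5_less_1)
  ultimately have "(\<lambda>n. fps_nth (fps_section 4 (fps_section 4 \<P>)) n * q ^ n) sums R q"
    by (rule has_fps_expansion_imp_sums_complex) (use q in \<open>simp add: one_ereal_def\<close>)
  hence "(\<Sum>n. of_nat (num_partitions (25 * int n + 24)) * q ^ n) = R q"
    unfolding fps_section_section_nth by (simp add: sums_iff)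
  thus "(\<Sum>n. of_nat (num_partitions (25 * int n + 24)) * q ^ n) =
          5 ^ 2 * 63 * (euler (q ^ 5) ^ 6 / euler q ^ 7)
        + 5 ^ 5 * q * 52 * (euler (q ^ 5) ^ 12 / euler q ^ 13)
        + 5 ^ 7 * q ^ 2 * 63 * (euler (q ^ 5) ^ 18 / euler q ^ 19)
        + 5 ^ 10 * q ^ 3 * 6 * (euler (q ^ 5) ^ 24 / euler q ^ 25)
        + 5 ^ 12 * q ^ 4 * (euler (q ^ 5) ^ 30 / euler q ^ 31)"
    by (simp add: R_def divide_inverse power_inverse mult_ac)
qed

lemma Omega5_L2:
  assumes "norm q < 1"
  shows "Omega5 0 L2 q = 5 * L2 q"
proof -
  have "(\<lambda>q. 5 * L2 q) has_fps_expansion 5 * fps_L2"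
    by (intro fps_expansion_intros L2_has_fps_expansion)
  moreover have "(\<lambda>q. 5 * L2 q) holomorphic_on eball 0 1"
    unfolding one_ereal_def eball_ereal by (intro holomorphic_intros holomorphic_L2)
  ultimately have "(\<lambda>n. fps_nth (fps_section 0 fps_L2) n * q ^ n) sums (5 * L2 q)"
    unfolding fps_section_L2
    by (rule has_fps_expansion_imp_sums_complex) (use assms in \<open>simp add: one_ereal_def\<close>)
  thus ?thesis
    by (simp add: Omega5_def fps_expansion_eqI[OF L2_has_fps_expansion] sums_iff)
qed

lemma fps_expansion_L2_Omega5: "fps_expansion (\<lambda>z. L2 z ^ 5 * Omega5 0 L2 z) 0 = 5 * fps_L2 ^ 6"
proof -
  have "\<forall>\<^sub>F z in nhds 0. L2 z ^ 5 * Omega5 0 L2 z = 5 * L2 z ^ 6"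
    using eventually_nhds_in_open[of "ball 0 1" "0 :: complex"]
    by (auto elim!: eventually_mono simp: Omega5_L2 eval_nat_numeral)
  hence "fps_expansion (\<lambda>z. L2 z ^ 5 * Omega5 0 L2 z) 0 = fps_expansion (\<lambda>z. 5 * L2 z ^ 6) 0"
    by (rule fps_expansion_cong)
  also have "\<dots> = 5 * fps_L2 ^ 6"
    by (rule fps_expansion_eqI) (intro fps_expansion_intros L2_has_fps_expansion)
  finally show ?thesis .
qed

definition fps_progression :: "nat \<Rightarrow> complex fps" where
  "fps_progression m = Abs_fps (\<lambda>n. of_nat (num_partitions (25 * int n + 5 * int m - 1)))"

lemma fps_section_L2_power:
  assumes "m < 5"
  shows "fps_section m (5 * fps_L2 ^ 6) = \<E> ^ 25 * (fps_X * fps_progression m)"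
proof -
  have "5 * fps_L2 ^ 6 = pow5 (\<E> ^ 25) * (fps_X ^ 6 * fps_section 4 \<P>)"
    unfolding fps_section_partitions
    by (simp add: fps_L2_def pow5_ring power_mult_distrib mult_ac flip: power_mult power_add)
  moreover have "fps_section m (fps_X ^ 6 * fps_section 4 \<P>) = fps_X * fps_progression m"
  proof (rule fps_ext)
    fix n
    show "fps_nth (fps_section m (fps_X ^ 6 * fps_section 4 \<P>)) n = fps_nth (fps_X * fps_progression m) n"
    proof (cases n)
      case (Suc k)
      show ?thesis
      proof (cases "5 * n + m < 6")
        case True
        hence "k = 0" "m = 0"
          using Suc by auto
        thus ?thesis
          by (simp add: Suc fps_X_power_mult_nth fps_progression_def)
      next
        case False
        hence "5 * (5 * n + m - 6) + 4 = 25 * k + 5 * m - 1" "1 \<le> 25 * k + 5 * m"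
          using Suc by auto
        thus ?thesis
          using False by (simp add: Suc fps_X_power_mult_nth fps_progression_def fps_partitions_def of_nat_diff)
      qed
    qed (use assms in \<open>simp add: fps_X_power_mult_nth\<close>)
  qed
  ultimately show ?thesis
    using assms by (simp add: fps_section_pow5_mult)
qed

lemma summable_section_partitions:
  assumes "norm q < 1" "c > 0"
  shows "summable (\<lambda>n. fps_nth \<P> (c * n + d) * q ^ n)"
proof (cases "q = 0")
  case False
  define r where "r = root c (norm q)"
  have r: "r > 0" "r ^ c = norm q"
    using False assms(2) by (simp_all add: r_def)
  have "r < 1"
    using assms r power_less1_D[of r c] by simp
  have "(\<lambda>q. inverse (euler q)) holomorphic_on eball 0 1"
    unfolding one_ereal_def eball_ereal by (intro holomorphic_intros) (auto simp: euler_nonzero)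
  hence "fps_conv_radius \<P> \<ge> 1"
    by (intro holomorphic_on_imp_fps_conv_radius_ge[OF inverse_euler_has_fps_expansion])
  hence "ereal (norm (of_real r :: complex)) < fps_conv_radius \<P>"
    using r \<open>r < 1\<close> by - (rule less_le_trans[of _ 1], auto)
  hence "summable (\<lambda>n. norm (fps_nth \<P> n * of_real r ^ n))"
    unfolding fps_conv_radius_def by (rule abs_summable_in_conv_radius)
  from summable_reindex[OF this, of "\<lambda>n. c * n + d"]
  have "summable ((\<lambda>n. norm (fps_nth \<P> n * of_real r ^ n)) \<circ> (\<lambda>n. c * n + d))"
    using assms(2) by (simp add: inj_on_def)
  moreover have "norm (fps_nth \<P> (c * n + d) * of_real r ^ (c * n + d)) = r ^ d * norm (fps_nth \<P> (c * n + d) * q ^ n)" for n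
  proof -
    have "norm (of_real r ^ (c * n + d) :: complex) = r ^ (c * n + d)"
      using r(1) by (simp add: norm_power)
    also have "\<dots> = norm q ^ n * r ^ d"
      by (simp only: power_add power_mult r(2))
    finally show ?thesis
      by (simp only: norm_mult norm_power mult_ac)
  qed
  ultimately have "summable (\<lambda>n. r ^ d * norm (fps_nth \<P> (c * n + d) * q ^ n))"
    by (simp only: o_def)
  hence "summable (\<lambda>n. norm (fps_nth \<P> (c * n + d) * q ^ n))"
    using r by (subst (asm) summable_cmult_iff) auto
  thus ?thesis
    by (rule summable_norm_cancel)
next
  case True
  thus ?thesis
    by (intro summable_finite[of "{0}"]) auto
qed

lemma fps_progression_sums:
  assumes "norm q < 1"
  shows "(\<lambda>n. fps_nth (fps_progression m) n * q ^ n) sums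
     (of_nat (num_partitions (5 * int m - 1)) + q * (\<Sum>n. of_nat (num_partitions (25 * int n + 24 + 5 * int m)) * q ^ n))"
proof -
  have nth: "fps_nth \<P> (25 * n + (24 + 5 * m)) = of_nat (num_partitions (25 * int n + 24 + 5 * int m))" for n
    by (simp add: fps_partitions_def algebra_simps)
  have nth': "fps_nth (fps_progression m) (Suc n) = of_nat (num_partitions (25 * int n + 24 + 5 * int m))" for n
    by (simp add: fps_progression_def algebra_simps)
  have "(\<lambda>n. of_nat (num_partitions (25 * int n + 24 + 5 * int m)) * q ^ n) sums
      (\<Sum>n. of_nat (num_partitions (25 * int n + 24 + 5 * int m)) * q ^ n)"
    using summable_section_partitions[OF assms, of 25 "24 + 5 * m"] unfolding nth by (intro summable_sums) auto
  from sums_mult[OF this, of q]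
  have "(\<lambda>n. fps_nth (fps_progression m) (Suc n) * q ^ Suc n) sums
      (q * (\<Sum>n. of_nat (num_partitions (25 * int n + 24 + 5 * int m)) * q ^ n))"
    unfolding nth' by (simp add: mult_ac)
  from sums_Suc[OF this] show ?thesis
    by (simp add: fps_progression_def add.commute)
qed

lemma eval_fps_product:
  fixes F :: "complex fps"
  assumes "\<And>q. norm q < 1 \<Longrightarrow> summable (\<lambda>n. fps_nth F n * q ^ n)" "norm q < 1"
  shows "eval_fps (\<E> ^ k * (fps_X * F)) q = euler q ^ k * (q * eval_fps F q)"
proof -
  have hol: "euler holomorphic_on ball 0 1"
    using holomorphic_euler[of "ball 0 1" "\<lambda>z. z"] by simp
  have "fps_conv_radius F \<ge> 1"
    unfolding fps_conv_radius_def
  proof (rule conv_radius_geI_ex)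
    fix r :: real assume r: "0 < r" "ereal r < 1"
    thus "\<exists>z. norm z = r \<and> summable (\<lambda>n. fps_nth F n * z ^ n)"
      using assms(1)[of "of_real r"] by (intro exI[of _ "of_real r"]) auto
  qed
  hence F: "ereal (norm q) < fps_conv_radius F"
    using assms(2) by - (rule less_le_trans[of _ 1], auto)
  have "fps_conv_radius \<E> \<ge> 1"
    using holomorphic_on_imp_fps_conv_radius_ge[OF euler_has_fps_expansion, of 1] hol
    by (simp add: one_ereal_def)
  hence E: "ereal (norm q) < fps_conv_radius \<E>"
    using assms(2) by - (rule less_le_trans[of _ 1], auto)
  have "eval_fps \<E> q = euler q"
    by (rule has_fps_expansion_imp_eval_fps_eq[OF euler_has_fps_expansion assms(2) hol])
  moreover have "ereal (norm q) < fps_conv_radius (fps_X * F)" "ereal (norm q) < fps_conv_radius (\<E> ^ k)"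
    using F E fps_conv_radius_mult[of fps_X F] fps_conv_radius_power[of \<E> k] by (auto intro: less_le_trans)
  ultimately show ?thesis
    using F E by (simp add: eval_fps_mult eval_fps_power)
qed

theorem dissection_identity_holds:
  assumes "m < 5"
  shows "dissection_identity m"
  unfolding dissection_identity_def
proof (intro allI impI)
  fix q :: complex assume "0 < norm q \<and> norm q < 1"
  hence q: "norm q < 1" "q \<noteq> 0"
    by auto
  define V where "V = of_nat (num_partitions (5 * int m - 1)) +
    q * (\<Sum>n. of_nat (num_partitions (25 * int n + 24 + 5 * int m)) * q ^ n)"
  have "eval_fps (fps_progression m) q = V"
    using fps_progression_sums[OF q(1), of m] by (simp add: eval_fps_def V_def sums_iff)
  moreover have "Omega5 m (\<lambda>z. L2 z ^ 5 * Omega5 0 L2 z) q = eval_fps (fps_section m (5 * fps_L2 ^ 6)) q"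
    by (subst Omega5_def) (simp only: fps_expansion_L2_Omega5 eval_fps_def fps_section_nth)
  ultimately have "Omega5 m (\<lambda>z. L2 z ^ 5 * Omega5 0 L2 z) q = euler q ^ 25 * (q * V)"
    unfolding fps_section_L2_power[OF assms]
    by (simp add: eval_fps_product sums_summable[OF fps_progression_sums] q)
  moreover have "E2 q ^ 5 * L2 q = q * euler q ^ 24"
    using euler_nonzero[OF q(1)] euler_nonzero[OF norm_power5_less_1[OF q(1)]]
    by (simp add: E2_eq_euler[OF q] L2_eq_euler[OF q(1)] field_simps flip: power_Suc power_add power_mult)
  moreover have "euler q * V = euler q ^ 25 * (q * V) / (q * euler q ^ 24)"
    using euler_nonzero[OF q(1)] q(2) by (simp add: field_simps flip: power_Suc)
  ultimately show "qpoch_inf q q *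
          (of_nat (num_partitions (5 * int m - 1)) +
           q * (\<Sum>n. of_nat (num_partitions (25 * int n + 24 + 5 * int m)) * q ^ n)) =
        Omega5 m (\<lambda>z. L2 z ^ 5 * Omega5 0 L2 z) q / (E2 q ^ 5 * L2 q)"
    unfolding V_def[symmetric] euler_def[symmetric] by (simp only:)
qed

theorem theorem5p2:
  shows "(\<forall>m \<in> {0..4}. dissection_identity m) \<and> (dissection_identity 0 \<longleftrightarrow> ramanujan_expansion)"
  using dissection_identity_holds ramanujan_expansion_holds by auto

end
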